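(* Let $\mathcal H$ be a real Hilbert space, $\gamma>0$, $\beta\ge 0$. Let $f\in C^1(\mathcal H)$ be real-valued with $\nabla f$ Lipschitz continuous on bounded subsets of $\mathcal H$ and $\inf_{\mathcal H}f>-\infty$. Let $\phi:\mathcal H\to\mathbb R\cup\{+\infty\}$ be proper, lower semicontinuous and convex with $\phi(0)=\min\phi=0$ and $r\mathbb B\subseteq\partial\phi(0)$ for some $r>0$. Let $x_0\in\mathcal H$, $v_0\in\mathrm{Dom}(\partial\phi)$, let $(x,v)$, $v=\dot x$, be the global strong solution of $$\ddot x(t)+\gamma\dot x(t)+\partial\phi(\dot x(t))+\nabla f(x(t)+\beta\dot x(t))\ni 0,\quad t\ge0,\qquad x(0)=x_0,\ \dot x(0)=v_0,$$ and set $y=x+\beta v$. Then the trajectory has finite length ($\int_0^{+\infty}\|v(t)\|dt<+\infty$) and there exists $x_\infty\in\mathcal H$ such that, strongly as $t\to+\infty$, $$x(t)\to x_\infty,\qquad v(t)\to0,\qquad y(t)\to x_\infty.$$ Moreover $-\nabla f(x_\infty)\in\partial\phi(0)$, and for every $t\ge0$ $$\|x(t)-x_\infty\|\le\int_t^{+\infty}\|v(s)\|\,ds.$$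
   Context: $\mathbb B$ is the closed unit ball of $\mathcal H$; $\partial\phi$ is the convex subdifferential and $\mathrm{Dom}(\partial\phi)=\{v:\partial\phi(v)\neq\varnothing\}$. A strong solution on $[0,T]$ is a pair $(x,v)$ with $x,v\in W^{1,2}(0,T;\mathcal H)$, $v=\dot x$ a.e., $x(0)=x_0$, $v(0)=v_0$, for which there exists $\xi\in L^2(0,T;\mathcal H)$ with $\xi(t)\in\partial\phi(v(t))$ and $\dot v(t)+\gamma v(t)+\xi(t)+\nabla f(x(t)+\beta v(t))=0$ for a.e. $t\in(0,T)$. A global strong solution is one whose restriction to every $[0,T]$ is a strong solution; under the stated hypotheses it exists and is unique. *)

theory Defs
  imports "HOL-Analysis.Analysis"
begin

subsection \<open>Extended-real-valued convex functions\<close>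

definition proper_fun :: "('a \<Rightarrow> ereal) \<Rightarrow> bool" where
  "proper_fun \<phi> \<longleftrightarrow> (\<forall>u. \<phi> u \<noteq> -\<infinity>) \<and> (\<exists>u. \<phi> u \<noteq> \<infinity>)"

definition lower_semicont :: "('a::topological_space \<Rightarrow> ereal) \<Rightarrow> bool" where
  "lower_semicont \<phi> \<longleftrightarrow> (\<forall>u. \<phi> u \<le> Liminf (at u) \<phi>)"

text \<open>The library constant \<^const>\<open>convex_on\<close> only covers real-valued functions. Note that
  \<open>0 * \<infinity> = 0\<close> in \<^typ>\<open>ereal\<close>; no \<open>\<infinity> - \<infinity>\<close> arises for proper functions.\<close>
definition convex_fun :: "('a::real_vector \<Rightarrow> ereal) \<Rightarrow> bool" where
  "convex_fun \<phi> \<longleftrightarrow>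
     (\<forall>u w. \<forall>a\<ge>0. \<forall>b\<ge>0. a + b = 1 \<longrightarrow>
        \<phi> (a *\<^sub>R u + b *\<^sub>R w) \<le> ereal a * \<phi> u + ereal b * \<phi> w)"

definition subdifferential :: "('a::real_inner \<Rightarrow> ereal) \<Rightarrow> 'a \<Rightarrow> 'a set" where
  "subdifferential \<phi> u = {p. \<bar>\<phi> u\<bar> \<noteq> \<infinity> \<and> (\<forall>w. \<phi> u + ereal (p \<bullet> (w - u)) \<le> \<phi> w)}"

definition dom_subdifferential :: "('a::real_inner \<Rightarrow> ereal) \<Rightarrow> 'a set" where
  "dom_subdifferential \<phi> = {u. subdifferential \<phi> u \<noteq> {}}"


subsection \<open>The spaces \<open>L\<^sup>2(0,T;H)\<close> and \<open>W\<^sup>1\<^sup>,\<^sup>2(0,T;H)\<close>\<close>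

text \<open>Bochner's notion of strong measurability (a.e. limit of simple functions). The Bochner
  integral of the library is restricted to second countable spaces, whereas the Hilbert space
  here need not be separable.\<close>
definition strongly_measurable :: "'b measure \<Rightarrow> ('b \<Rightarrow> 'a::real_normed_vector) \<Rightarrow> bool" where
  "strongly_measurable M u \<longleftrightarrow>
     (\<exists>s :: nat \<Rightarrow> 'b \<Rightarrow> 'a. (\<forall>n. simple_function M (s n)) \<and>
        (AE t in M. (\<lambda>n. s n t) \<longlonglongrightarrow> u t))"

definition L2 :: "real \<Rightarrow> (real \<Rightarrow> 'a::real_normed_vector) set" where
  "L2 T = {u. strongly_measurable (lebesgue_on {0<..<T}) u \<and>
              integrable (lebesgue_on {0<..<T}) (\<lambda>t. (norm (u t))\<^sup>2)}"

text \<open>Finite families of non-overlapping subintervals \<open>[a, b]\<close> of \<open>S\<close> are represented by finite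
  sets of pairs of endpoints.\<close>
definition abs_cont_on :: "real set \<Rightarrow> (real \<Rightarrow> 'a::real_normed_vector) \<Rightarrow> bool" where
  "abs_cont_on S u \<longleftrightarrow>
     (\<forall>\<epsilon>>0. \<exists>\<delta>>0. \<forall>I. finite I \<longrightarrow>
        (\<forall>(a, b)\<in>I. a \<le> b \<and> {a..b} \<subseteq> S) \<longrightarrow>
        disjoint_family_on (\<lambda>(a, b). {a<..<b}) I \<longrightarrow>
        (\<Sum>(a, b)\<in>I. b - a) < \<delta> \<longrightarrow>
        (\<Sum>(a, b)\<in>I. norm (u b - u a)) < \<epsilon>)"

text \<open>For Hilbert-space-valued functions on a bounded interval, \<open>W\<^sup>1\<^sup>,\<^sup>2(0,T;H)\<close> consists of
  the absolutely continuous functions on \<open>[0,T]\<close> whose pointwise a.e. derivative lies in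
  \<open>L\<^sup>2(0,T;H)\<close>. Elements are identified with their continuous representative, which gives
  meaning to initial values and to pointwise statements.\<close>
definition W12 :: "real \<Rightarrow> (real \<Rightarrow> 'a::real_normed_vector) set" where
  "W12 T = {u. abs_cont_on {0..T} u \<and>
               (AE t in lebesgue_on {0<..<T}. u differentiable (at t)) \<and>
               (\<lambda>t. vector_derivative u (at t)) \<in> L2 T}"


subsection \<open>Strong solutions\<close>

text \<open>The argument \<open>g\<close> plays the role of the gradient of \<open>f\<close>.\<close>
definition strong_solution ::
  "real \<Rightarrow> real \<Rightarrow> ('a::real_inner \<Rightarrow> ereal) \<Rightarrow> ('a \<Rightarrow> 'a) \<Rightarrow> 'a \<Rightarrow> 'a \<Rightarrow>
   real \<Rightarrow> (real \<Rightarrow> 'a) \<Rightarrow> (real \<Rightarrow> 'a) \<Rightarrow> bool" where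
  "strong_solution \<gamma> \<beta> \<phi> g x0 v0 T x v \<longleftrightarrow>
     x \<in> W12 T \<and> v \<in> W12 T \<and>
     (AE t in lebesgue_on {0<..<T}. v t = vector_derivative x (at t)) \<and>
     x 0 = x0 \<and> v 0 = v0 \<and>
     (\<exists>\<xi>\<in>L2 T. AE t in lebesgue_on {0<..<T}.
        \<xi> t \<in> subdifferential \<phi> (v t) \<and>
        vector_derivative v (at t) + \<gamma> *\<^sub>R v t + \<xi> t + g (x t + \<beta> *\<^sub>R v t) = 0)"

definition global_strong_solution ::
  "real \<Rightarrow> real \<Rightarrow> ('a::real_inner \<Rightarrow> ereal) \<Rightarrow> ('a \<Rightarrow> 'a) \<Rightarrow> 'a \<Rightarrow> 'a \<Rightarrow>
   (real \<Rightarrow> 'a) \<Rightarrow> (real \<Rightarrow> 'a) \<Rightarrow> bool" where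
  "global_strong_solution \<gamma> \<beta> \<phi> g x0 v0 x v \<longleftrightarrow>
     (\<forall>T>0. strong_solution \<gamma> \<beta> \<phi> g x0 v0 T x v)"

end

theory Submission
  imports Defs
begin

text \<open>Write \<open>\<xi> = -(v' + \<gamma> v + \<nabla>f(y)) \<in> \<partial>\<phi>(v)\<close>. Pairing this identity with \<open>y' = v + \<beta> v'\<close>
  gives, for \<open>E = (1 + \<beta> \<gamma>)/2 \<parallel>v\<parallel>\<^sup>2 + f(y)\<close>,
  \<open>E' = -\<langle>\<xi>, v\<rangle> - \<gamma> \<parallel>v\<parallel>\<^sup>2 - \<beta> \<parallel>v'\<parallel>\<^sup>2 - \<beta> \<langle>\<xi>, v'\<rangle>\<close>. Dry friction yields
  \<open>\<langle>\<xi>, v\<rangle> \<ge> \<phi>(v) \<ge> r \<parallel>v\<parallel>\<close>, and \<open>\<integral>\<langle>\<xi>, v'\<rangle> \<ge> -\<phi>(v\<^sub>0)\<close> by the chain rule for \<open>\<phi> \<circ> v\<close>, so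
  \<open>\<integral>\<parallel>v\<parallel> < \<infinity>\<close> and \<open>x\<close> converges. As \<open>y\<close> is bounded, \<open>(\<parallel>v\<parallel>\<^sup>2)' \<le> 2K \<parallel>v\<parallel>\<close> with integrable
  right-hand side, whence \<open>v \<rightarrow> 0\<close>. If \<open>\<phi>(w) < -\<langle>\<nabla>f(x\<^sub>\<infinity>), w\<rangle>\<close> for some \<open>w\<close>, then
  \<open>\<parallel>v - w\<parallel>\<^sup>2\<close> would eventually decrease at a uniform rate, which is absurd.\<close>

subsection \<open>Absolutely continuous functions\<close>

lemma abs_cont_onD:
  assumes "abs_cont_on S u" "e > 0"
  obtains d where "d > 0"
    and "\<And>I. finite I \<Longrightarrow> (\<And>a b. (a, b) \<in> I \<Longrightarrow> a \<le> b \<and> {a..b} \<subseteq> S) \<Longrightarrow>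
      disjoint_family_on (\<lambda>(a, b). {a<..<b}) I \<Longrightarrow> (\<Sum>(a, b)\<in>I. b - a) < d \<Longrightarrow>
      (\<Sum>(a, b)\<in>I. norm (u b - u a)) < e"
proof -
  from assms obtain d where "d > 0" and *: "\<forall>I. finite I \<longrightarrow>
        (\<forall>(a, b)\<in>I. a \<le> b \<and> {a..b} \<subseteq> S) \<longrightarrow>
        disjoint_family_on (\<lambda>(a, b). {a<..<b}) I \<longrightarrow>
        (\<Sum>(a, b)\<in>I. b - a) < d \<longrightarrow>
        (\<Sum>(a, b)\<in>I. norm (u b - u a)) < e"
    unfolding abs_cont_on_def by blast
  show thesis
  proof (rule that[OF \<open>d > 0\<close>])
    fix I :: "(real \<times> real) set"
    assume I: "finite I" "\<And>a b. (a, b) \<in> I \<Longrightarrow> a \<le> b \<and> {a..b} \<subseteq> S"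
      "disjoint_family_on (\<lambda>(a, b). {a<..<b}) I" "(\<Sum>(a, b)\<in>I. b - a) < d"
    have "\<forall>(a, b)\<in>I. a \<le> b \<and> {a..b} \<subseteq> S" using I(2) by auto
    with I(1,3,4) show "(\<Sum>(a, b)\<in>I. norm (u b - u a)) < e"
      by (intro *[THEN spec, THEN mp, THEN mp, THEN mp, THEN mp])
  qed
qed

lemma abs_cont_on_subset: "abs_cont_on S u \<Longrightarrow> T \<subseteq> S \<Longrightarrow> abs_cont_on T u"
proof -
  assume u: "abs_cont_on S u" and TS: "T \<subseteq> S"
  show ?thesis
    unfolding abs_cont_on_def
  proof (intro allI impI)
    fix e :: real assume "e > 0"
    obtain d where d: "d > 0"
      "\<And>I. finite I \<Longrightarrow> (\<And>a b. (a, b) \<in> I \<Longrightarrow> a \<le> b \<and> {a..b} \<subseteq> S) \<Longrightarrow>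
        disjoint_family_on (\<lambda>(a, b). {a<..<b}) I \<Longrightarrow> (\<Sum>(a, b)\<in>I. b - a) < d \<Longrightarrow>
        (\<Sum>(a, b)\<in>I. norm (u b - u a)) < e"
      using abs_cont_onD[OF u \<open>e > 0\<close>] by blast
    show "\<exists>\<delta>>0. \<forall>I. finite I \<longrightarrow> (\<forall>(a, b)\<in>I. a \<le> b \<and> {a..b} \<subseteq> T) \<longrightarrow>
        disjoint_family_on (\<lambda>(a, b). {a<..<b}) I \<longrightarrow> (\<Sum>(a, b)\<in>I. b - a) < \<delta> \<longrightarrow>
        (\<Sum>(a, b)\<in>I. norm (u b - u a)) < e"
    proof (intro exI[of _ d] conjI allI impI d(1))
      fix I :: "(real \<times> real) set"
      assume I: "finite I" "\<forall>(a, b)\<in>I. a \<le> b \<and> {a..b} \<subseteq> T"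
        "disjoint_family_on (\<lambda>(a, b). {a<..<b}) I" "(\<Sum>(a, b)\<in>I. b - a) < d"
      have "a \<le> b \<and> {a..b} \<subseteq> S" if "(a, b) \<in> I" for a b
        using bspec[OF I(2) that] TS by auto
      then show "(\<Sum>(a, b)\<in>I. norm (u b - u a)) < e"
        by (rule d(2)[OF I(1) _ I(3,4)])
    qed
  qed
qed

text \<open>Sums over any family inherit the bound on increments. Two dominating functions are
  allowed because \<open>y = x + \<beta> *\<^sub>R v\<close> moves with both \<open>x\<close> and
  \<open>v\<close>; a single one is entered twice.\<close>

lemma abs_cont_on_dominated:
  assumes u: "abs_cont_on S u" and w: "abs_cont_on S w"
    and z: "\<And>a b. a \<in> S \<Longrightarrow> b \<in> S \<Longrightarrow> norm (z b - z a) \<le> K * (norm (u b - u a) + norm (w b - w a))"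
  shows "abs_cont_on S z"
  unfolding abs_cont_on_def
proof (intro allI impI)
  fix e :: real assume "e > 0"
  \<comment> \<open>Replaces \<open>K\<close>, which may have either sign, by a positive constant
    that can serve as a divisor.\<close>
  define K' where "K' = \<bar>K\<bar> + 1"
  have K': "K' > 0" "K \<le> K'" by (auto simp: K'_def)
  have "e / (2 * K') > 0" using \<open>e > 0\<close> K' by simp
  obtain d1 where d1: "d1 > 0"
    "\<And>I. finite I \<Longrightarrow> (\<And>a b. (a, b) \<in> I \<Longrightarrow> a \<le> b \<and> {a..b} \<subseteq> S) \<Longrightarrow>
      disjoint_family_on (\<lambda>(a, b). {a<..<b}) I \<Longrightarrow> (\<Sum>(a, b)\<in>I. b - a) < d1 \<Longrightarrow>
      (\<Sum>(a, b)\<in>I. norm (u b - u a)) < e / (2 * K')"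
    using abs_cont_onD[OF u \<open>e / (2 * K') > 0\<close>] by blast
  obtain d2 where d2: "d2 > 0"
    "\<And>I. finite I \<Longrightarrow> (\<And>a b. (a, b) \<in> I \<Longrightarrow> a \<le> b \<and> {a..b} \<subseteq> S) \<Longrightarrow>
      disjoint_family_on (\<lambda>(a, b). {a<..<b}) I \<Longrightarrow> (\<Sum>(a, b)\<in>I. b - a) < d2 \<Longrightarrow>
      (\<Sum>(a, b)\<in>I. norm (w b - w a)) < e / (2 * K')"
    using abs_cont_onD[OF w \<open>e / (2 * K') > 0\<close>] by blast
  show "\<exists>\<delta>>0. \<forall>I. finite I \<longrightarrow> (\<forall>(a, b)\<in>I. a \<le> b \<and> {a..b} \<subseteq> S) \<longrightarrow>
           disjoint_family_on (\<lambda>(a, b). {a<..<b}) I \<longrightarrow> (\<Sum>(a, b)\<in>I. b - a) < \<delta> \<longrightarrow>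
           (\<Sum>(a, b)\<in>I. norm (z b - z a)) < e"
  proof (rule exI[of _ "min d1 d2"], intro conjI allI impI)
    fix I :: "(real \<times> real) set"
    assume I: "finite I" "\<forall>(a, b)\<in>I. a \<le> b \<and> {a..b} \<subseteq> S"
      "disjoint_family_on (\<lambda>(a, b). {a<..<b}) I" "(\<Sum>(a, b)\<in>I. b - a) < min d1 d2"
    have ends: "a \<in> S" "b \<in> S" if "(a, b) \<in> I" for a b
      using I(2) that by force+
    have "(\<Sum>(a, b)\<in>I. norm (z b - z a)) \<le> (\<Sum>(a, b)\<in>I. K' * (norm (u b - u a) + norm (w b - w a)))"
      unfolding case_prod_beta
    proof (rule sum_mono)
      fix p assume "p \<in> I"
      then have "norm (z (snd p) - z (fst p))
          \<le> K * (norm (u (snd p) - u (fst p)) + norm (w (snd p) - w (fst p)))"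
        by (intro z ends[of "fst p" "snd p"]) auto
      also have "\<dots> \<le> K' * (norm (u (snd p) - u (fst p)) + norm (w (snd p) - w (fst p)))"
        using K' by (intro mult_right_mono) auto
      finally show "norm (z (snd p) - z (fst p))
          \<le> K' * (norm (u (snd p) - u (fst p)) + norm (w (snd p) - w (fst p)))" .
    qed
    also have "\<dots> = K' * ((\<Sum>(a, b)\<in>I. norm (u b - u a)) + (\<Sum>(a, b)\<in>I. norm (w b - w a)))"
      by (simp add: case_prod_beta sum.distrib flip: sum_distrib_left)
    also have "\<dots> < K' * (e / (2 * K') + e / (2 * K'))"
      using K' d1(2)[OF I(1) _ I(3)] d2(2)[OF I(1) _ I(3)] I(2,4)
      by (intro mult_strict_left_mono add_strict_mono) auto
    also have "\<dots> = e" using K' by simp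
    finally show "(\<Sum>(a, b)\<in>I. norm (z b - z a)) < e" .
  qed (use d1 d2 in auto)
qed

lemma abs_cont_on_imp_continuous_on:
  fixes a b :: real
  assumes "abs_cont_on {a..b} u"
  shows "continuous_on {a..b} u"
  unfolding continuous_on_iff
proof (intro ballI allI impI)
  fix t e :: real assume t: "t \<in> {a..b}" and "e > 0"
  obtain d where d: "d > 0"
    "\<And>I. finite I \<Longrightarrow> (\<And>c d. (c, d) \<in> I \<Longrightarrow> c \<le> d \<and> {c..d} \<subseteq> {a..b}) \<Longrightarrow>
      disjoint_family_on (\<lambda>(a, b). {a<..<b}) I \<Longrightarrow> (\<Sum>(a, b)\<in>I. b - a) < d \<Longrightarrow>
      (\<Sum>(a, b)\<in>I. norm (u b - u a)) < e"
    using abs_cont_onD[OF assms \<open>e > 0\<close>] by blast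
  have "dist (u s) (u t) < e" if "s \<in> {a..b}" "dist s t < d" for s
  proof -
    have "(\<Sum>(a, b)\<in>{(min s t, max s t)}. norm (u b - u a)) < e"
      by (rule d(2)) (use t that in \<open>auto simp: disjoint_family_on_def dist_real_def\<close>)
    then show ?thesis
      by (cases "s \<le> t") (simp_all add: dist_norm norm_minus_commute min_def max_def)
  qed
  with d(1) show "\<exists>d>0. \<forall>s\<in>{a..b}. dist s t < d \<longrightarrow> dist (u s) (u t) < e"
    by blast
qed

text \<open>Subintervals tagged in the exceptional set are absorbed, by absolute continuity, into an open
  set of small measure; the others obey the usual straddle estimate.\<close>
theorem abs_cont_on_fundamental_theorem:
  fixes u :: "real \<Rightarrow> 'b::real_normed_vector"
  assumes ab: "a \<le> b" and ac: "abs_cont_on {a..b} u" and N: "negligible N"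
    and der: "\<And>t. a < t \<Longrightarrow> t < b \<Longrightarrow> t \<notin> N \<Longrightarrow> (u has_vector_derivative u' t) (at t)"
  shows "(u' has_integral (u b - u a)) {a..b}"
proof (cases "a = b")
  case False
  with ab have "a < b" by simp
  \<comment> \<open>The derivative is given only inside the interval, so the end points join the
    exceptional set. With \<open>w = 0\<close> on \<open>Z\<close>, a tag in \<open>Z\<close> leaves
    only the increment of \<open>u\<close> to estimate.\<close>
  define Z where "Z = N \<union> {a, b}"
  define w where "w t = (if t \<in> Z then 0 else u' t)" for t
  have Z: "negligible Z" using N unfolding Z_def by (intro negligible_Un negligible_finite[of "{a, b}"]) auto
  have "(w has_integral (u b - u a)) {a..b}"
    unfolding has_integral_factor_content_real
  proof (intro allI impI)
    fix e :: real assume "e > 0"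
    \<comment> \<open>Half of the permitted error \<open>e * (b - a)\<close> is for tags in
      \<open>Z\<close>; the slope error \<open>e/2\<close> below uses the other half.\<close>
    define e1 where "e1 = e * (b - a) / 2"
    have "e1 > 0" using \<open>e > 0\<close> \<open>a < b\<close> by (simp add: e1_def)
    obtain d where d: "d > 0"
      "\<And>I. finite I \<Longrightarrow> (\<And>c d. (c, d) \<in> I \<Longrightarrow> c \<le> d \<and> {c..d} \<subseteq> {a..b}) \<Longrightarrow>
        disjoint_family_on (\<lambda>(a, b). {a<..<b}) I \<Longrightarrow> (\<Sum>(a, b)\<in>I. b - a) < d \<Longrightarrow>
        (\<Sum>(a, b)\<in>I. norm (u b - u a)) < e1"
      using abs_cont_onD[OF ac \<open>e1 > 0\<close>] by blast
    obtain G where G: "open G" "Z \<subseteq> G" "G - Z \<in> lmeasurable" "emeasure lebesgue (G - Z) < ennreal d"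
      using sets_lebesgue_outer_open[OF negligible_imp_sets[OF Z] d(1)] by blast
    have Gm: "G \<in> lmeasurable"
      using fmeasurable.Un[OF G(3) negligible_imp_measurable[OF Z]] G(2) by (simp add: Un_absorb2)
    have "measure lebesgue G = measure lebesgue (G - Z)"
      by (metis Diff_empty Gm N Z fmeasurableD measure_Diff_null_set negligible_iff_null_sets)
    also have "\<dots> < d"
      using G(3,4) d(1) by (simp add: emeasure_eq_measure2 ennreal_less_iff)
    finally have Gd: "measure lebesgue G < d" .
    have "\<exists>k>0. \<forall>s. norm (s - t) < k \<longrightarrow> norm (u s - u t - (s - t) *\<^sub>R w t) \<le> e/2 * norm (s - t)"
      if "a \<le> t" "t \<le> b" "t \<notin> Z" for t
    proof -
      have "(u has_vector_derivative w t) (at t)"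
        using that der[of t] by (auto simp: w_def Z_def)
      then have "\<forall>e>0. \<exists>k>0. \<forall>s. norm (s - t) < k \<longrightarrow> norm (u s - u t - (s - t) *\<^sub>R w t) \<le> e * norm (s - t)"
        unfolding has_vector_derivative_def has_derivative_within_alt by simp
      then show ?thesis using \<open>e > 0\<close> half_gt_zero by blast
    qed
    then obtain k where k: "\<And>t. a \<le> t \<Longrightarrow> t \<le> b \<Longrightarrow> t \<notin> Z \<Longrightarrow> k t > 0"
      "\<And>t s. a \<le> t \<Longrightarrow> t \<le> b \<Longrightarrow> t \<notin> Z \<Longrightarrow> norm (s - t) < k t \<Longrightarrow>
        norm (u s - u t - (s - t) *\<^sub>R w t) \<le> e/2 * norm (s - t)"
      by metis
    \<comment> \<open>On \<open>Z\<close> the gauge is all of \<open>G\<close>, so every interval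
      tagged there lies in \<open>G\<close>. The radius 1 outside \<open>[a, b]\<close> is a default
      that keeps \<open>g\<close> a gauge.\<close>
    define g where "g t = (if t \<in> Z then G else ball t (if a \<le> t \<and> t \<le> b then k t else 1))" for t
    show "\<exists>g. gauge g \<and> (\<forall>p. p tagged_division_of {a..b} \<and> g fine p \<longrightarrow>
      norm ((\<Sum>(t, K)\<in>p. measure lborel K *\<^sub>R w t) - (u b - u a)) \<le> e * measure lborel {a..b})"
    proof (intro exI[of _ g] conjI allI impI)
      show "gauge g"
        using G(1,2) k(1) by (auto simp: gauge_def g_def)
      fix p assume p: "p tagged_division_of {a..b} \<and> g fine p"
      note tag = tagged_division_ofD[OF conjunct1[OF p]]
      have iv: "\<exists>c d. K = {c..d} \<and> c \<le> t \<and> t \<le> d \<and> a \<le> c \<and> d \<le> b" if tK: "(t, K) \<in> p" for t K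
      proof -
        obtain c d where "K = cbox c d" using tag(4)[OF tK] by blast
        with tag(2,3)[OF tK] show ?thesis by (intro exI[of _ c] exI[of _ d]) auto
      qed
      define pZ where "pZ = {(t, K) \<in> p. t \<in> Z}"
      have pZ: "pZ \<subseteq> p" by (auto simp: pZ_def)
      \<comment> \<open>The passage from tagged sums to sums over intervals requires the value 0 on
        all degenerate boxes, the empty one included.\<close>
      define h where "h K = (if K = {} then 0 else u (Sup K) - u (Inf K))" for K
      have nonempty: "(t, {}) \<notin> p" for t using tag(2) by blast
      have "(\<Sum>(t, K)\<in>p. u (Sup K) - u (Inf K)) = (\<Sum>(t, K)\<in>p. h K)"
        using nonempty by (intro sum.cong) (auto simp: h_def)
      then have sum_h: "(\<Sum>(t, K)\<in>p. h K) = u b - u a"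
        using additive_tagged_division_1[of a b p u] p ab by simp
      have part: "pZ tagged_partial_division_of {a..b}"
        using tagged_partial_division_subset[OF _ pZ] p by (auto simp: tagged_division_of_def)
      note tagZ = tagged_partial_division_of_Union_self[OF part]
      have "norm ((\<Sum>(t, K)\<in>p. measure lborel K *\<^sub>R w t) - (u b - u a))
          = norm (\<Sum>(t, K)\<in>p. measure lborel K *\<^sub>R w t - h K)"
        unfolding sum_h[symmetric] by (simp add: sum_subtractf case_prod_beta)
      also have "\<dots> = norm ((\<Sum>(t, K)\<in>p - pZ. measure lborel K *\<^sub>R w t - h K) + (\<Sum>(t, K)\<in>pZ. measure lborel K *\<^sub>R w t - h K))"
        by (subst sum.subset_diff[OF pZ tag(1)]) (rule refl)
      also have "\<dots> \<le> (\<Sum>(t, K)\<in>p - pZ. norm (measure lborel K *\<^sub>R w t - h K)) + (\<Sum>(t, K)\<in>pZ. norm (measure lborel K *\<^sub>R w t - h K))"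
        unfolding case_prod_beta by (intro norm_triangle_le add_mono norm_sum)
      finally have split: "norm ((\<Sum>(t, K)\<in>p. measure lborel K *\<^sub>R w t) - (u b - u a))
        \<le> (\<Sum>(t, K)\<in>p - pZ. norm (measure lborel K *\<^sub>R w t - h K)) + (\<Sum>(t, K)\<in>pZ. norm (measure lborel K *\<^sub>R w t - h K))" .
      have "(\<Sum>(t, K)\<in>p - pZ. norm (measure lborel K *\<^sub>R w t - h K)) \<le> (\<Sum>(t, K)\<in>p - pZ. e/2 * measure lborel K)"
        unfolding case_prod_beta
      proof (rule sum_mono)
        fix q assume q: "q \<in> p - pZ"
        obtain t K where tK: "q = (t, K)" by force
        with q have "(t, K) \<in> p" and tZ: "t \<notin> Z" by (auto simp: pZ_def)
        from iv[OF this(1)] obtain c d where cd: "K = {c..d}" "c \<le> t" "t \<le> d" "a \<le> c" "d \<le> b" by blast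
        have "K \<subseteq> g t" using p \<open>(t, K) \<in> p\<close> by (auto simp: fine_def)
        then have "c \<in> ball t (k t)" "d \<in> ball t (k t)"
          using tZ cd by (auto simp: g_def simp del: mem_ball)
        then have kt: "norm (c - t) < k t" "norm (d - t) < k t"
          by (auto simp: dist_real_def)
        have tab: "a \<le> t" "t \<le> b" using cd by auto
        \<comment> \<open>Straddle estimate: the tag lies between \<open>c\<close> and
          \<open>d\<close>, so the errors at the two ends add up to
          \<open>e/2 * (d - c)\<close>.\<close>
        have "norm ((d - c) *\<^sub>R w t - (u d - u c))
          = norm ((u c - u t - (c - t) *\<^sub>R w t) - (u d - u t - (d - t) *\<^sub>R w t))"
          by (simp add: algebra_simps)
        also have "\<dots> \<le> e/2 * norm (c - t) + e/2 * norm (d - t)"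
          by (rule order_trans[OF norm_triangle_ineq4 add_mono[OF k(2)[OF tab tZ kt(1)] k(2)[OF tab tZ kt(2)]]])
        also have "\<dots> = e/2 * (d - c)" using cd by (simp add: field_simps)
        finally show "norm (measure lborel (snd q) *\<^sub>R w (fst q) - h (snd q)) \<le> e/2 * measure lborel (snd q)"
          using cd by (simp add: tK h_def)
      qed
      also have "(\<Sum>(t, K)\<in>p - pZ. e/2 * measure lborel K) \<le> (\<Sum>(t, K)\<in>p. e/2 * measure lborel K)"
        using tag(1) \<open>e > 0\<close> by (intro sum_mono2) auto
      also have "\<dots> = e/2 * (\<Sum>(t, K)\<in>p. measure lborel K)"
        unfolding sum_distrib_left by (simp add: case_prod_beta)
      also have "(\<Sum>(t, K)\<in>p. measure lborel K) = b - a"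
        using additive_content_tagged_division[of p a b] p ab by simp
      finally have good: "(\<Sum>(t, K)\<in>p - pZ. norm (measure lborel K *\<^sub>R w t - h K)) \<le> e/2 * (b - a)" .
      \<comment> \<open>\<open>abs_cont_on\<close> sums over a set of endpoint pairs, so distinct
        intervals must not share a pair.\<close>
      have inj: "inj_on (\<lambda>K. (Inf K, Sup K)) (snd ` pZ)"
      proof (rule inj_onI)
        fix K L assume "K \<in> snd ` pZ" "L \<in> snd ` pZ" and eq: "(Inf K, Sup K) = (Inf L, Sup L)"
        then obtain s t where "(s, K) \<in> p" "(t, L) \<in> p" by (auto simp: pZ_def)
        from iv[OF this(1)] iv[OF this(2)] eq show "K = L" by force
      qed
      have "(\<Sum>(t, K)\<in>pZ. norm (measure lborel K *\<^sub>R w t - h K)) = (\<Sum>(t, K)\<in>pZ. norm (h K))"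
        by (rule sum.cong) (auto simp: pZ_def w_def)
      also have "\<dots> = (\<Sum>K\<in>snd ` pZ. norm (h K))"
      proof (rule sum.over_tagged_division_lemma[OF tagZ])
        show "norm (h (cbox c d)) = 0" if "box c d = {}" for c d
          using that by (cases "c = d") (auto simp: h_def)
      qed
      also have "\<dots> = (\<Sum>(c, d)\<in>(\<lambda>K. (Inf K, Sup K)) ` snd ` pZ. norm (u d - u c))"
      proof -
        have "(\<Sum>K\<in>snd ` pZ. norm (h K)) = (\<Sum>K\<in>snd ` pZ. norm (u (Sup K) - u (Inf K)))"
          using nonempty pZ by (intro sum.cong) (auto simp: h_def)
        also have "\<dots> = (\<Sum>(c, d)\<in>(\<lambda>K. (Inf K, Sup K)) ` snd ` pZ. norm (u d - u c))"
          by (subst sum.reindex[OF inj]) (simp add: o_def)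
        finally show ?thesis .
      qed
      also have "\<dots> < e1"
      proof (rule d(2))
        have div: "snd ` pZ division_of \<Union>(snd ` pZ)"
          by (rule division_of_tagged_division[OF tagZ])
        have ivZ: "\<exists>c d. K = {c..d} \<and> c \<le> d \<and> a \<le> c \<and> d \<le> b \<and> K \<subseteq> G" if "K \<in> snd ` pZ" for K
        proof -
          from that obtain t where t: "(t, K) \<in> p" "t \<in> Z" by (auto simp: pZ_def)
          then have "K \<subseteq> g t" using p by (auto simp: fine_def)
          then have "K \<subseteq> G" using t(2) by (simp add: g_def)
          moreover obtain c d where "K = {c..d}" "c \<le> t" "t \<le> d" "a \<le> c" "d \<le> b"
            using iv[OF t(1)] by blast
          ultimately show ?thesis by (intro exI[of _ c] exI[of _ d]) simp
        qed
        show "finite ((\<lambda>K. (Inf K, Sup K)) ` snd ` pZ)"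
          using tag(1) pZ finite_subset by blast
        show "c \<le> d \<and> {c..d} \<subseteq> {a..b}" if "(c, d) \<in> (\<lambda>K. (Inf K, Sup K)) ` snd ` pZ" for c d
        proof -
          from that obtain K where "K \<in> snd ` pZ" "c = Inf K" "d = Sup K" by auto
          moreover from ivZ[OF this(1)] obtain c' d' where "K = {c'..d'}" "c' \<le> d'" "a \<le> c'" "d' \<le> b" by blast
          ultimately show ?thesis by simp
        qed
        show "disjoint_family_on (\<lambda>(a, b). {a<..<b}) ((\<lambda>K. (Inf K, Sup K)) ` snd ` pZ)"
          unfolding disjoint_family_on_def
        proof (intro ballI impI)
          fix q q' assume q: "q \<in> (\<lambda>K. (Inf K, Sup K)) ` snd ` pZ" "q' \<in> (\<lambda>K. (Inf K, Sup K)) ` snd ` pZ" "q \<noteq> q'"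
          obtain K where K: "K \<in> snd ` pZ" "q = (Inf K, Sup K)" using q(1) by (rule imageE)
          obtain L where L: "L \<in> snd ` pZ" "q' = (Inf L, Sup L)" using q(2) by (rule imageE)
          have KL: "K \<in> snd ` pZ" "L \<in> snd ` pZ" "K \<noteq> L" "q = (Inf K, Sup K)" "q' = (Inf L, Sup L)"
            using K L q(3) by blast+
          have "interior K \<inter> interior L = {}"
            using division_ofD(5)[OF div KL(1-3)] .
          moreover obtain c d where "K = {c..d}" "c \<le> d" using ivZ[OF KL(1)] by blast
          moreover obtain c' d' where "L = {c'..d'}" "c' \<le> d'" using ivZ[OF KL(2)] by blast
          ultimately show "(case q of (a, b) \<Rightarrow> {a<..<b}) \<inter> (case q' of (a, b) \<Rightarrow> {a<..<b}) = {}"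
            using KL(4,5) by (simp add: interior_atLeastAtMost_real)
        qed
        have "(\<Sum>(c, d)\<in>(\<lambda>K. (Inf K, Sup K)) ` snd ` pZ. d - c) = (\<Sum>K\<in>snd ` pZ. Sup K - Inf K)"
          by (subst sum.reindex[OF inj]) (simp add: o_def)
        also have "\<dots> = (\<Sum>K\<in>snd ` pZ. measure lebesgue K)"
        proof (rule sum.cong)
          fix K assume "K \<in> snd ` pZ"
          from ivZ[OF this] obtain c d where "K = {c..d}" "c \<le> d" by blast
          then show "Sup K - Inf K = measure lebesgue K" by simp
        qed simp
        also have "\<dots> = measure lebesgue (\<Union>(snd ` pZ))"
          by (rule content_division[OF div])
        also have "\<dots> \<le> measure lebesgue G"
        proof (rule measure_mono_fmeasurable)
          show "\<Union>(snd ` pZ) \<subseteq> G" using ivZ by blast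
        qed (use Gm lmeasurable_division[OF div] in auto)
        also note Gd
        finally show "(\<Sum>(c, d)\<in>(\<lambda>K. (Inf K, Sup K)) ` snd ` pZ. d - c) < d" .
      qed
      finally show "norm ((\<Sum>(t, K)\<in>p. measure lborel K *\<^sub>R w t) - (u b - u a)) \<le> e * measure lborel {a..b}"
        using ab split good by (simp add: e1_def)
    qed
  qed
  then show ?thesis
    by (rule has_integral_spike[OF Z, rotated]) (simp add: w_def)
qed (use has_integral_refl(2) in auto)


subsection \<open>Integration lemmas\<close>

text \<open>Setting both functions to 0 on \<open>N\<close> makes the comparison hold everywhere and
  affects the integrability of neither.\<close>

lemma integrable_on_bounded_AE:
  fixes h :: "real \<Rightarrow> real"
  assumes "h \<in> borel_measurable (lebesgue_on {a..b})" "k integrable_on {a..b}" "negligible N"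
    and "\<And>t. t \<in> {a..b} - N \<Longrightarrow> \<bar>h t\<bar> \<le> k t"
  shows "h integrable_on {a..b}"
proof -
  define h' where "h' t = (if t \<in> N then 0 else h t)" for t
  define k' where "k' t = (if t \<in> N then 0 else k t)" for t
  have N: "N \<in> sets lebesgue" using assms(3) by (rule negligible_imp_sets)
  have "h' = (\<lambda>t. indicator (- N) t * h t)" by (auto simp: h'_def)
  moreover have "(\<lambda>t. indicator (- N) t * h t) \<in> borel_measurable (lebesgue_on {a..b})"
    using N by (intro borel_measurable_times assms(1) measurable_restrict_space1 borel_measurable_indicator)
      (simp add: Compl_in_sets_lebesgue)
  ultimately have "h' \<in> borel_measurable (lebesgue_on {a..b})" by simp
  moreover have "k' integrable_on {a..b}"
    by (rule integrable_spike[OF assms(2,3)]) (simp add: k'_def)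
  ultimately have "h' integrable_on {a..b}"
    by (rule measurable_bounded_by_integrable_imp_integrable)
      (use assms(4) in \<open>auto simp: h'_def k'_def\<close>)
  then show ?thesis
    by (rule integrable_spike[OF _ assms(3)]) (simp add: h'_def)
qed

text \<open>Fatou's lemma is applied to the majorants: off \<open>N\<close> the limit
  \<open>f\<close> is at most the liminf of the \<open>b n\<close>, so integrability has to be
  checked for the \<open>b n\<close> rather than for the \<open>F n\<close>.\<close>

lemma Fatou_majorants:
  fixes F :: "nat \<Rightarrow> real \<Rightarrow> real"
  assumes f: "f integrable_on S" and b: "\<And>n. b n integrable_on S" and N: "negligible N"
    and F: "\<And>n t. t \<in> S - N \<Longrightarrow> 0 \<le> F n t \<and> F n t \<le> b n t"
    and lim: "\<And>t. t \<in> S - N \<Longrightarrow> (\<lambda>n. F n t) \<longlonglongrightarrow> f t"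
    and C: "\<And>n. integral S (b n) \<le> C"
  shows "integral S f \<le> C"
proof -
  define f' where "f' t = (if t \<in> N then 0 else f t)" for t
  define b' where "b' n t = (if t \<in> N then 0 else b n t)" for n t
  have f': "(f' has_integral integral S f) S"
    by (rule has_integral_spike[OF N _ integrable_integral[OF f]]) (simp add: f'_def)
  have b': "(b' n has_integral integral S (b n)) S" for n
    by (rule has_integral_spike[OF N _ integrable_integral[OF b]]) (simp add: b'_def)
  have f'0: "0 \<le> f' t" if "t \<in> S" for t
    using that F lim[of t] by (auto simp: f'_def intro: LIMSEQ_le_const)
  have b'0: "0 \<le> b' n t" if "t \<in> S" for n t
    using that F[of t n] by (auto simp: b'_def)
  \<comment> \<open>\<open>ennreal\<close> sends negative numbers to 0, so the final bound can be
    read back in the reals only for nonnegative \<open>C\<close>.\<close>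
  have C0: "0 \<le> C"
    using has_integral_nonneg[OF b'[of 0] b'0] C[of 0] by simp
  have "ennreal (integral S f) = (\<integral>\<^sup>+t. ennreal (indicator S t * f' t) \<partial>lebesgue)"
    using nn_integral_has_integral_lebesgue[OF f'0 f'] by (simp add: nn_integral_completion)
  also have "\<dots> \<le> (\<integral>\<^sup>+t. liminf (\<lambda>n. ennreal (indicator S t * b' n t)) \<partial>lebesgue)"
  proof (rule nn_integral_mono)
    fix t :: real
    show "ennreal (indicator S t * f' t) \<le> liminf (\<lambda>n. ennreal (indicator S t * b' n t))"
    proof (cases "t \<in> S - N")
      case True
      have "(\<lambda>n. ennreal (F n t)) \<longlonglongrightarrow> ennreal (f t)"
        by (rule tendsto_ennrealI[OF lim[OF True]])
      then have "ennreal (f t) = liminf (\<lambda>n. ennreal (F n t))"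
        by (intro lim_imp_Liminf[symmetric]) simp_all
      also have "\<dots> \<le> liminf (\<lambda>n. ennreal (b n t))"
        using F[OF True] by (intro Liminf_mono always_eventually allI ennreal_leI) blast
      finally show ?thesis using True by (simp add: f'_def b'_def)
    qed (auto simp: f'_def indicator_def)
  qed
  also have "\<dots> \<le> liminf (\<lambda>n. \<integral>\<^sup>+t. ennreal (indicator S t * b' n t) \<partial>lebesgue)"
  proof (rule nn_integral_liminf)
    fix n
    show "(\<lambda>t. ennreal (indicator S t * b' n t)) \<in> borel_measurable lebesgue"
      using has_integral_implies_lebesgue_measurable[OF b'[of n]] by simp
  qed
  also have "\<dots> = liminf (\<lambda>n. ennreal (integral S (b n)))"
    using nn_integral_has_integral_lebesgue[OF b'0 b'] by (simp add: nn_integral_completion)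
  also have "\<dots> \<le> liminf (\<lambda>n. ennreal C)"
    using C by (intro Liminf_mono always_eventually allI ennreal_leI)
  also have "\<dots> = ennreal C" by (simp add: Liminf_const)
  finally show ?thesis using C0 by simp
qed

text \<open>The integrals of \<open>w\<close> and of its shift overlap on \<open>[0, T - h]\<close>
  and cancel there, leaving two strips of width \<open>h\<close>.\<close>

lemma has_integral_backward_difference:
  fixes w :: "real \<Rightarrow> real"
  assumes w: "w integrable_on {-h..T}" and h: "0 \<le> h" "h \<le> T"
  shows "((\<lambda>t. w t - w (t - h)) has_integral (integral {T-h..T} w - integral {-h..0} w)) {0..T}"
proof -
  have i: "w integrable_on {a..b}" if "-h \<le> a" "b \<le> T" for a b
    by (rule integrable_on_subinterval[OF w]) (use that in auto)
  have "(w has_integral integral {-h..T-h} w) {-h..T-h}"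
    using h by (intro integrable_integral i) auto
  from has_integral_shift_real_ivl[OF this, of "-h"]
  have "((\<lambda>t. w (t - h)) has_integral integral {-h..T-h} w) {0..T}" by simp
  moreover have "(w has_integral integral {0..T} w) {0..T}"
    using h by (intro integrable_integral i) auto
  ultimately have "((\<lambda>t. w t - w (t - h)) has_integral (integral {0..T} w - integral {-h..T-h} w)) {0..T}"
    by (intro has_integral_diff)
  moreover have "integral {0..T} w - integral {-h..T-h} w = integral {T-h..T} w - integral {-h..0} w"
    using Henstock_Kurzweil_Integration.integral_combine[of "-h" 0 T w]
      Henstock_Kurzweil_Integration.integral_combine[of "-h" "T-h" T w] h w by simp
  ultimately show ?thesis by simp
qed

lemma has_vector_derivative_quotient:
  fixes V :: "real \<Rightarrow> 'a::real_normed_vector"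
  assumes "(V has_vector_derivative d) (at t)"
  shows "((\<lambda>h. (V (t + h) - V t) /\<^sub>R h) \<longlongrightarrow> d) (at 0)"
proof -
  have "((\<lambda>h. norm (V (t + h) - V t - h *\<^sub>R d) / norm h) \<longlongrightarrow> 0) (at 0)"
    using assms unfolding has_vector_derivative_def has_derivative_at by blast
  then have "((\<lambda>h. norm ((V (t + h) - V t) /\<^sub>R h - d)) \<longlongrightarrow> 0) (at 0)"
  proof (rule Lim_transform_eventually)
    have "norm (V (t + h) - V t - h *\<^sub>R d) / norm h = norm ((V (t + h) - V t) /\<^sub>R h - d)" if "h \<noteq> 0" for h
    proof -
      have "(V (t + h) - V t) /\<^sub>R h - d = (V (t + h) - V t - h *\<^sub>R d) /\<^sub>R h"
        using that by (simp add: scaleR_diff_right)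
      then show ?thesis by (simp add: divide_inverse_commute)
    qed
    then show "\<forall>\<^sub>F h in at 0. norm (V (t + h) - V t - h *\<^sub>R d) / norm h = norm ((V (t + h) - V t) /\<^sub>R h - d)"
      by (auto simp: eventually_at_filter)
  qed
  then show ?thesis
    by (rule LIM_zero_cancel[OF tendsto_norm_zero_cancel])
qed

text \<open>Off \<open>N\<close> this is the pointwise limit of the continuous functions obtained by
  pairing difference quotients of \<open>V\<close> with \<open>G\<close>. The pairing keeps
  everything real-valued, so the argument covers nonseparable spaces.\<close>

lemma borel_measurable_inner_derivative:
  fixes V :: "real \<Rightarrow> 'a::real_inner"
  assumes V: "continuous_on UNIV V" and G: "continuous_on {a..b} G" and N: "negligible N"
    and d: "\<And>t. t \<in> {a..b} - N \<Longrightarrow> (V has_vector_derivative dV t) (at t)"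
  shows "(\<lambda>t. dV t \<bullet> G t) \<in> borel_measurable (lebesgue_on {a..b})"
proof -
  define q where "q n t = (V (t + inverse (real (Suc n))) - V t) /\<^sub>R inverse (real (Suc n))" for n t
  have Nm: "indicator (- N) \<in> borel_measurable (lebesgue_on {a..b})"
    using negligible_imp_sets[OF N]
    by (intro measurable_restrict_space1 borel_measurable_indicator) (simp add: Compl_in_sets_lebesgue)
  have "(\<lambda>t. indicator (- N) t * (dV t \<bullet> G t)) \<in> borel_measurable (lebesgue_on {a..b})"
  proof (rule borel_measurable_LIMSEQ_real)
    fix n
    have "continuous_on {a..b} (\<lambda>t. q n t \<bullet> G t)"
      unfolding q_def
      by (intro continuous_intros G continuous_on_compose2[OF V]) auto
    then show "(\<lambda>t. indicator (- N) t * (q n t \<bullet> G t)) \<in> borel_measurable (lebesgue_on {a..b})"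
      by (intro borel_measurable_times Nm continuous_imp_measurable_on_sets_lebesgue) auto
  next
    fix t assume "t \<in> space (lebesgue_on {a..b})"
    then have t: "t \<in> {a..b}" by simp
    show "(\<lambda>n. indicator (- N) t * (q n t \<bullet> G t)) \<longlonglongrightarrow> indicator (- N) t * (dV t \<bullet> G t)"
    proof (cases "t \<in> N")
      case False
      with t have "(V has_vector_derivative dV t) (at t)" by (intro d) auto
      then have "((\<lambda>h. (V (t + h) - V t) /\<^sub>R h) \<longlongrightarrow> dV t) (at 0)"
        by (rule has_vector_derivative_quotient)
      moreover have "filterlim (\<lambda>n. inverse (real (Suc n))) (at 0) sequentially"
        unfolding filterlim_at using LIMSEQ_inverse_real_of_nat by (auto simp del: of_nat_Suc)
      ultimately have "(\<lambda>n. q n t) \<longlonglongrightarrow> dV t"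
        unfolding q_def by (rule filterlim_compose)
      then show ?thesis by (intro tendsto_intros)
    qed simp
  qed
  then have "(\<lambda>t. indicator (- N) t * (dV t \<bullet> G t)) measurable_on {a..b}"
    by (simp add: measurable_on_iff_borel_measurable)
  then have "(\<lambda>t. dV t \<bullet> G t) measurable_on {a..b}"
    by (rule measurable_on_spike[OF _ N]) simp
  then show ?thesis
    by (simp add: measurable_on_iff_borel_measurable)
qed


subsection \<open>Dissipative trajectories\<close>

text \<open>Constant continuation to negative times, which lets backward differences reach past time
  0.\<close>

lemma continuous_on_half_line_extension:
  fixes u :: "real \<Rightarrow> 'b::topological_space"
  assumes "\<And>T. 0 < T \<Longrightarrow> continuous_on {0..T} u"
  shows "continuous_on UNIV (\<lambda>t. u (max 0 t))"
proof -
  have "isCont (\<lambda>t. u (max 0 t)) t" for t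
  proof -
    have "continuous_on {..<\<bar>t\<bar> + 1} (\<lambda>t. u (max 0 t))"
      by (rule continuous_on_compose2[OF assms[of "\<bar>t\<bar> + 1"]]) (auto intro!: continuous_intros)
    then show ?thesis
      by (simp add: continuous_on_eq_continuous_at)
  qed
  then show ?thesis by (simp add: continuous_on_eq_continuous_at)
qed

section \<open>Measurability of \<open>\<phi>\<close> along a continuous curve\<close>

lemma lower_semicont_open_superlevel:
  assumes "lower_semicont \<phi>"
  shows "open {u. c < \<phi> u}"
  unfolding open_subopen[of "{u. c < \<phi> u}"]
proof safe
  fix u assume c: "c < \<phi> u"
  then have "c < Liminf (at u) \<phi>"
    using assms unfolding lower_semicont_def by (metis less_le_trans)
  then have "\<forall>\<^sub>F w in at u. c < \<phi> w"
    by (rule less_LiminfD)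
  then obtain S where "open S" "u \<in> S" "\<And>w. w \<in> S \<Longrightarrow> w \<noteq> u \<Longrightarrow> c < \<phi> w"
    unfolding eventually_at_topological by blast
  \<comment> \<open>The filter \<open>at u\<close> leaves out \<open>u\<close> itself; that point is
    covered by \<open>c\<close>.\<close>
  with c show "\<exists>T. open T \<and> u \<in> T \<and> T \<subseteq> {u. c < \<phi> u}"
    by (intro exI[of _ S]) auto
qed

lemma borel_measurable_lower_semicont_compose:
  fixes V :: "real \<Rightarrow> 'a::topological_space"
  assumes "lower_semicont \<phi>" "continuous_on UNIV V"
  shows "(\<lambda>t. \<phi> (V t)) \<in> borel_measurable borel"
proof (rule borel_measurableI_greater)
  fix c
  have "open (V -` {u. c < \<phi> u})"
    using assms lower_semicont_open_superlevel by (intro open_vimage) auto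
  then show "{t \<in> space borel. c < \<phi> (V t)} \<in> sets borel"
    by (simp add: vimage_def)
qed

text \<open>Gathers what the analysis uses of a global strong solution: one null set
  \<open>N\<close> serving all horizons, a pointwise derivative \<open>dv\<close>, the selection of
  the subdifferential eliminated through the equation, a gradient bounded on bounded sets, and a
  lower bound \<open>m\<close> of \<open>f\<close>.\<close>

locale dissipative_trajectory =
  fixes f :: "'a::{real_inner, complete_space} \<Rightarrow> real" and g :: "'a \<Rightarrow> 'a" and \<phi> :: "'a \<Rightarrow> ereal"
    and \<gamma> \<beta> r m :: real and x v dv :: "real \<Rightarrow> 'a" and N :: "real set"
  assumes gamma: "\<gamma> > 0" and beta: "\<beta> \<ge> 0"
    and grad: "\<And>z. GDERIV f z :> g z"
    and g_cont: "continuous_on UNIV g"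
    and g_bounded: "\<And>R. \<exists>K. \<forall>z. norm z \<le> R \<longrightarrow> norm (g z) \<le> K"
    and f_lower: "\<And>z. m \<le> f z"
    and lsc: "lower_semicont \<phi>"
    and phi_0: "\<phi> 0 = 0" and phi_nonneg: "\<And>z. 0 \<le> \<phi> z"
    and r_pos: "r > 0" and ball: "cball 0 r \<subseteq> subdifferential \<phi> 0"
    and phi_v0: "\<phi> (v 0) \<noteq> \<infinity>"
    and ac_x: "\<And>T. 0 < T \<Longrightarrow> abs_cont_on {0..T} x"
    and ac_v: "\<And>T. 0 < T \<Longrightarrow> abs_cont_on {0..T} v"
    and N: "negligible N"
    and x_deriv: "\<And>t. 0 < t \<Longrightarrow> t \<notin> N \<Longrightarrow> (x has_vector_derivative v t) (at t)"
    and v_deriv: "\<And>t. 0 < t \<Longrightarrow> t \<notin> N \<Longrightarrow> (v has_vector_derivative dv t) (at t)"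
    and inclusion: "\<And>t. 0 < t \<Longrightarrow> t \<notin> N \<Longrightarrow>
      - (dv t + \<gamma> *\<^sub>R v t + g (x t + \<beta> *\<^sub>R v t)) \<in> subdifferential \<phi> (v t)"
    and dv_sq: "\<And>T. 0 < T \<Longrightarrow> (\<lambda>t. (norm (dv t))\<^sup>2) integrable_on {0..T}"
begin

section \<open>The selection \<open>\<xi>\<close> and the subgradient inequality along the
  trajectory\<close>

definition y :: "real \<Rightarrow> 'a" where "y t = x t + \<beta> *\<^sub>R v t"
definition V :: "real \<Rightarrow> 'a" where "V t = v (max 0 t)"
text \<open>The terms of the equation without a derivative. They are continuous in time, so
  integrability questions about \<open>\<xi>\<close> reduce to \<open>dv\<close>.\<close>

definition F :: "real \<Rightarrow> 'a" where "F t = \<gamma> *\<^sub>R v t + g (y t)"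
definition \<xi> :: "real \<Rightarrow> 'a" where "\<xi> t = - (dv t + F t)"
text \<open>The value \<open>P t\<close> is junk where \<open>\<phi> (V t) = \<infinity>\<close>, which happens only on the null set \<open>N\<close>.\<close>
definition P :: "real \<Rightarrow> real" where "P t = real_of_ereal (\<phi> (V t))"

lemma cont_x: "0 < T \<Longrightarrow> continuous_on {0..T} x"
  by (rule abs_cont_on_imp_continuous_on[OF ac_x])

lemma cont_v: "0 < T \<Longrightarrow> continuous_on {0..T} v"
  by (rule abs_cont_on_imp_continuous_on[OF ac_v])

lemma cont_V: "continuous_on UNIV V"
  unfolding V_def by (rule continuous_on_half_line_extension[OF cont_v])

lemma cont_F: "0 < T \<Longrightarrow> continuous_on {0..T} F"
  unfolding F_def y_def
  by (intro continuous_intros cont_x cont_v continuous_on_compose2[OF g_cont]) auto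

lemma V_eq [simp]: "0 \<le> t \<Longrightarrow> V t = v t"
  by (simp add: V_def)

lemma V_deriv: "(V has_vector_derivative dv t) (at t)" if "0 < t" "t \<notin> N"
  by (rule has_vector_derivative_transform_within_open[OF v_deriv[OF that], of "{0<..}"]) (use that in auto)

lemma xi_subdifferential: "0 < t \<Longrightarrow> t \<notin> N \<Longrightarrow> \<xi> t \<in> subdifferential \<phi> (v t)"
  using inclusion[of t] by (simp add: \<xi>_def F_def y_def add.assoc)

lemma phi_eq_P: "0 \<le> t \<Longrightarrow> t \<notin> N \<Longrightarrow> \<phi> (v t) = ereal (P t)"
  using xi_subdifferential[of t] phi_v0 phi_nonneg[of "v 0"]
  by (cases "t = 0") (auto simp: P_def subdifferential_def ereal_real)

lemma phi_v0_eq_P: "\<phi> (v 0) = ereal (P 0)"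
  using phi_v0 phi_nonneg[of "v 0"] by (auto simp: P_def ereal_real)

lemma P_nonneg: "0 \<le> P t"
  using phi_nonneg[of "V t"] by (simp add: P_def real_of_ereal_pos)

lemma P_neg: "t \<le> 0 \<Longrightarrow> P t = P 0"
  by (simp add: P_def V_def max_def)

lemma subgradient:
  assumes "0 < t" "t \<notin> N"
  shows "ereal (P t + \<xi> t \<bullet> (w - v t)) \<le> \<phi> w"
  using xi_subdifferential[OF assms] phi_eq_P[of t] assms
  by (auto simp: subdifferential_def)

text \<open>For \<open>s \<le> 0\<close> the point \<open>V s = v 0\<close> has a finite value of
  \<open>\<phi>\<close> by assumption, whether or not \<open>s\<close> lies in \<open>N\<close>; so
  the inequality also serves backward differences near time 0.\<close>

lemma subgradient_P:
  assumes "0 < t" "t \<notin> N" "s \<le> 0 \<or> s \<notin> N"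
  shows "P t + \<xi> t \<bullet> (V s - v t) \<le> P s"
proof (cases "s \<le> 0")
  case True
  then show ?thesis
    using subgradient[OF assms(1,2), of "v 0"] phi_v0_eq_P P_neg[of s] by (simp add: V_def max_def)
next
  case False
  then show ?thesis
    using subgradient[OF assms(1,2), of "v s"] phi_eq_P[of s] assms(3) by simp
qed

text \<open>Test point 0, where \<open>\<phi>\<close> vanishes.\<close>

lemma P_le_xi_v: "0 < t \<Longrightarrow> t \<notin> N \<Longrightarrow> P t \<le> \<xi> t \<bullet> v t"
  using subgradient[of t 0] phi_0 by (simp add: zero_ereal_def)

text \<open>Dry friction: the ball hypothesis supplies a subgradient at 0 of length \<open>r\<close>
  pointing in the direction of \<open>w\<close>.\<close>

lemma phi_coercive: "ereal (r * norm w) \<le> \<phi> w"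
proof (cases "w = 0")
  case False
  define p where "p = (r / norm w) *\<^sub>R w"
  have "p \<in> cball 0 r" using r_pos False by (simp add: p_def)
  then have "\<phi> 0 + ereal (p \<bullet> (w - 0)) \<le> \<phi> w"
    using ball unfolding subdifferential_def by blast
  moreover have "p \<bullet> (w - 0) = r * norm w"
    using False by (simp add: p_def dot_square_norm power2_eq_square)
  ultimately show ?thesis by (simp add: phi_0)
qed (simp add: phi_0)

lemma xi_v_ge: "0 < t \<Longrightarrow> t \<notin> N \<Longrightarrow> r * norm (v t) \<le> \<xi> t \<bullet> v t"
  using phi_coercive[of "v t"] phi_eq_P[of t] P_le_xi_v[of t] by simp

section \<open>Integrals of \<open>dv\<close> and increments of \<open>v\<close>\<close>

lemma integrable_inner_dv:
  assumes T: "0 < T" and G: "continuous_on {0..T} G"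
  shows "(\<lambda>t. dv t \<bullet> G t) integrable_on {0..T}"
proof (rule integrable_on_bounded_AE)
  show "(\<lambda>t. dv t \<bullet> G t) \<in> borel_measurable (lebesgue_on {0..T})"
    by (rule borel_measurable_inner_derivative[OF cont_V G negligible_Un[OF N negligible_sing[of 0]]])
      (auto intro!: V_deriv)
  show "(\<lambda>t. (norm (dv t))\<^sup>2 + (norm (G t))\<^sup>2) integrable_on {0..T}"
    by (intro integrable_add dv_sq[OF T] integrable_continuous_real continuous_intros G)
  show "\<bar>dv t \<bullet> G t\<bar> \<le> (norm (dv t))\<^sup>2 + (norm (G t))\<^sup>2" for t
  proof -
    have "\<bar>dv t \<bullet> G t\<bar> \<le> norm (dv t) * norm (G t)" by (rule Cauchy_Schwarz_ineq2)
    also have "\<dots> \<le> (norm (dv t))\<^sup>2 + (norm (G t))\<^sup>2"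
      using sum_squares_bound[of "norm (dv t)" "norm (G t)"]
        mult_nonneg_nonneg[OF norm_ge_zero[of "dv t"] norm_ge_zero[of "G t"]] by linarith
    finally show ?thesis .
  qed
qed (rule negligible_empty)

text \<open>Pairing with a fixed vector makes the integrals real, so that they can be compared;
  later \<open>e\<close> is the increment itself, which recovers its norm.\<close>

lemma inner_FTC:
  assumes "0 \<le> s" "s \<le> t"
  shows "((\<lambda>\<tau>. dv \<tau> \<bullet> e) has_integral ((v t - v s) \<bullet> e)) {s..t}"
    and "((\<lambda>\<tau>. v \<tau> \<bullet> e) has_integral ((x t - x s) \<bullet> e)) {s..t}"
proof -
  \<comment> \<open>One argument for both pairs, \<open>(v, dv)\<close> and
    \<open>(x, v)\<close>.\<close>
  have "((\<lambda>\<tau>. du \<tau> \<bullet> e) has_integral (u t \<bullet> e - u s \<bullet> e)) {s..t}"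
    if ac: "\<And>T. 0 < T \<Longrightarrow> abs_cont_on {0..T} u"
      and d: "\<And>t. 0 < t \<Longrightarrow> t \<notin> N \<Longrightarrow> (u has_vector_derivative du t) (at t)" for u du
  proof (rule abs_cont_on_fundamental_theorem[OF assms(2) _ N])
    have ac': "abs_cont_on {s..t} u"
      by (rule abs_cont_on_subset[OF ac[of "t + 1"]]) (use assms in auto)
    have bd: "norm (u b \<bullet> e - u a \<bullet> e) \<le> norm e * (norm (u b - u a) + norm (u b - u a))" for a b
    proof -
      have "norm (u b \<bullet> e - u a \<bullet> e) \<le> norm (u b - u a) * norm e"
        using Cauchy_Schwarz_ineq2[of "u b - u a" e] by (simp add: inner_diff_left)
      also have "\<dots> \<le> norm e * (norm (u b - u a) + norm (u b - u a))"
        by (simp add: distrib_left mult.commute)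
      finally show ?thesis .
    qed
    show "abs_cont_on {s..t} (\<lambda>\<tau>. u \<tau> \<bullet> e)"
      by (rule abs_cont_on_dominated[OF ac' ac' bd])
    show "((\<lambda>\<tau>. u \<tau> \<bullet> e) has_vector_derivative du \<tau> \<bullet> e) (at \<tau>)" if "s < \<tau>" "\<tau> < t" "\<tau> \<notin> N" for \<tau>
      using bounded_linear.has_vector_derivative[OF bounded_linear_inner_left d[of \<tau>]] that assms by simp
  qed
  from this[OF ac_v v_deriv] this[OF ac_x x_deriv]
  show "((\<lambda>\<tau>. dv \<tau> \<bullet> e) has_integral ((v t - v s) \<bullet> e)) {s..t}"
    "((\<lambda>\<tau>. v \<tau> \<bullet> e) has_integral ((x t - x s) \<bullet> e)) {s..t}"
    by (simp_all add: inner_diff_left)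
qed

text \<open>A monotone control of the increments of \<open>v\<close>. For \<open>t < 0\<close> the
  interval is empty and \<open>M t = 0\<close>, in accordance with the constant extension
  \<open>V\<close>.\<close>

definition M :: "real \<Rightarrow> real" where "M t = integral {0..t} (\<lambda>s. (norm (dv s))\<^sup>2)"

lemma integrable_dv_sq: "0 \<le> s \<Longrightarrow> (\<lambda>t. (norm (dv t))\<^sup>2) integrable_on {s..t}"
  by (rule integrable_on_subinterval[OF dv_sq[of "\<bar>t\<bar> + 1"]]) auto

lemma M_diff: "M t - M s = integral {s..t} (\<lambda>\<tau>. (norm (dv \<tau>))\<^sup>2)" if "0 \<le> s" "s \<le> t"
  using Henstock_Kurzweil_Integration.integral_combine[OF that integrable_dv_sq[of 0]]
  by (simp add: M_def)

lemma M_neg: "t \<le> 0 \<Longrightarrow> M t = 0"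
  by (cases "t = 0") (simp_all add: M_def)

lemma M_mono: "mono M"
proof (rule monoI)
  fix s t :: real assume "s \<le> t"
  have nn: "0 \<le> integral {a..b} (\<lambda>\<tau>. (norm (dv \<tau>))\<^sup>2)" if "0 \<le> a" for a b
    by (rule integral_nonneg[OF integrable_dv_sq[OF that]]) simp
  show "M s \<le> M t"
  proof (cases "0 \<le> s")
    case True
    then show ?thesis using M_diff[OF True \<open>s \<le> t\<close>] nn[OF True] by (metis diff_ge_0_iff_ge)
  next
    case False
    then show ?thesis using M_neg[of s] nn[of 0 t] by (simp add: M_def)
  qed
qed

text \<open>Cauchy-Schwarz for the integral of \<open>dv\<close>: test with the increment
  \<open>e\<close> and apply Young's inequality with weight \<open>t - s\<close>, so that the second
  term integrates to half the square of \<open>norm e\<close> and is absorbed.\<close>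

lemma increment_bound:
  assumes "0 \<le> s" "s \<le> t"
  shows "(norm (v t - v s))\<^sup>2 \<le> (t - s) * (M t - M s)"
proof (cases "s = t")
  case False
  with assms have st: "s < t" by simp
  define e where "e = v t - v s"
  have "(norm e)\<^sup>2 \<le> integral {s..t} (\<lambda>\<tau>. (t - s) / 2 * (norm (dv \<tau>))\<^sup>2 + (norm e)\<^sup>2 / (2 * (t - s)))"
  proof (rule has_integral_le)
    show "((\<lambda>\<tau>. dv \<tau> \<bullet> e) has_integral (norm e)\<^sup>2) {s..t}"
      using inner_FTC(1)[OF assms, of e] by (simp add: e_def dot_square_norm)
    show "((\<lambda>\<tau>. (t - s) / 2 * (norm (dv \<tau>))\<^sup>2 + (norm e)\<^sup>2 / (2 * (t - s))) has_integral
        integral {s..t} (\<lambda>\<tau>. (t - s) / 2 * (norm (dv \<tau>))\<^sup>2 + (norm e)\<^sup>2 / (2 * (t - s)))) {s..t}"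
      by (intro integrable_integral integrable_add integrable_on_mult_right integrable_dv_sq assms integrable_const_ivl)
    fix \<tau> assume "\<tau> \<in> {s..t}"
    have "dv \<tau> \<bullet> e \<le> norm (dv \<tau>) * norm e" by (rule norm_cauchy_schwarz)
    also have "\<dots> \<le> (t - s) / 2 * (norm (dv \<tau>))\<^sup>2 + (norm e)\<^sup>2 / (2 * (t - s))"
    proof -
      have "0 \<le> ((t - s) * norm (dv \<tau>) - norm e)\<^sup>2 / (2 * (t - s))" using st by simp
      also have "\<dots> = (t - s) / 2 * (norm (dv \<tau>))\<^sup>2 + (norm e)\<^sup>2 / (2 * (t - s)) - norm (dv \<tau>) * norm e"
        using st by (simp add: power2_eq_square divide_simps) (simp add: algebra_simps)
      finally show ?thesis by simp
    qed
    finally show "dv \<tau> \<bullet> e \<le> (t - s) / 2 * (norm (dv \<tau>))\<^sup>2 + (norm e)\<^sup>2 / (2 * (t - s))" .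
  qed
  also have "\<dots> = (t - s) / 2 * (M t - M s) + (norm e)\<^sup>2 / 2"
  proof -
    have "(t - s) * ((norm e)\<^sup>2 / (2 * (t - s))) = (norm e)\<^sup>2 / 2"
      using st by (simp add: divide_simps)
    then show ?thesis
      using assms st integrable_dv_sq[OF assms(1), of t]
      by (subst integral_add) (simp_all add: M_diff integrable_on_mult_right integrable_const_ivl)
  qed
  finally show ?thesis by (simp add: e_def)
qed simp

lemma increment_bound_V:
  assumes "0 \<le> t" "0 < h"
  shows "(norm (V t - V (t - h)))\<^sup>2 \<le> h * (M t - M (t - h))"
proof (cases "h \<le> t")
  case True
  then show ?thesis using increment_bound[of "t - h" t] assms by simp
next
  case False
  \<comment> \<open>Here \<open>V (t - h) = v 0\<close> and \<open>M (t - h) = 0\<close>; replacing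
    \<open>t\<close> by the larger \<open>h\<close> only weakens the bound.\<close>
  have "(norm (v t - v 0))\<^sup>2 \<le> t * M t"
    using increment_bound[of 0 t] assms M_neg[of 0] by simp
  also have "\<dots> \<le> h * M t"
    using False monoD[OF M_mono, of 0 t] M_neg[of 0] assms by (intro mult_right_mono) auto
  finally show ?thesis using False assms M_neg[of "t - h"] by (simp add: V_def max_def)
qed

end


subsection \<open>The chain rule inequality\<close>

lemma has_integral_le_AE:
  fixes p q :: "real \<Rightarrow> real"
  assumes p: "(p has_integral i) S" and q: "(q has_integral j) S" and Z: "negligible Z"
    and le: "\<And>t. t \<in> S - Z \<Longrightarrow> p t \<le> q t"
  shows "i \<le> j"
proof -
  have "((\<lambda>t. if t \<in> Z then p t else q t) has_integral j) S"
    by (rule has_integral_spike[OF Z _ q]) simp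
  then show ?thesis
    by (rule has_integral_le[OF p]) (use le in auto)
qed

context dissipative_trajectory
begin

text \<open>For positive times off \<open>N\<close>, \<open>P\<close> lies between 0 and
  \<open>\<xi> t \<bullet> v t\<close>, which the equation splits into \<open>dv\<close> paired with
  \<open>v\<close> and a continuous term; on negative times \<open>P\<close> is constant.\<close>

lemma integrable_P:
  assumes "0 < T" "0 \<le> h"
  shows "P integrable_on {-h..T}"
proof -
  have "P integrable_on {0..T}"
  proof (rule integrable_on_bounded_AE)
    have "P \<in> borel_measurable lborel"
      unfolding P_def using borel_measurable_lower_semicont_compose[OF lsc cont_V] by simp
    then show "P \<in> borel_measurable (lebesgue_on {0..T})"
      by (intro measurable_restrict_space1 measurable_completion)
    have "(\<lambda>t. - (dv t \<bullet> v t) - F t \<bullet> v t) integrable_on {0..T}"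
      using assms
      by (intro integrable_diff integrable_neg integrable_inner_dv integrable_continuous_real
          continuous_intros cont_v cont_F)
    moreover have "(\<lambda>t. - (dv t \<bullet> v t) - F t \<bullet> v t) = (\<lambda>t. \<xi> t \<bullet> v t)"
      by (simp add: \<xi>_def inner_add_left inner_diff_left fun_eq_iff)
    ultimately show "(\<lambda>t. \<xi> t \<bullet> v t) integrable_on {0..T}" by simp
    show "negligible (N \<union> {0})" by (intro negligible_Un N negligible_sing)
    show "\<bar>P t\<bar> \<le> \<xi> t \<bullet> v t" if "t \<in> {0..T} - (N \<union> {0})" for t
      using P_le_xi_v[of t] P_nonneg[of t] that by auto
  qed
  moreover have "P integrable_on {-h..0}"
    by (rule integrable_eq[OF integrable_const_ivl[of "P 0"]]) (metis P_neg atLeastAtMost_iff)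
  ultimately show ?thesis
    using assms Henstock_Kurzweil_Integration.integrable_combine[of "-h" 0 T P] by simp
qed

text \<open>The chain rule \<open>(\<phi> \<circ> v)' = \<langle>\<xi>, v'\<rangle>\<close> is only needed as an inequality. For backward difference
  quotients the subgradient inequality gives \<open>\<langle>\<xi>(t), v(t) - v(t - h)\<rangle> \<ge> \<phi>(v(t)) - \<phi>(v(t - h))\<close>,
  also for \<open>t < h\<close> once \<open>v\<close> is extended by \<open>v(0)\<close>, and the right-hand side telescopes. Since the
  quotients are bounded in \<open>L\<^sup>2\<close> by \<open>v'\<close>, Fatou's lemma applied to \<open>\<parallel>\<xi> - q\<parallel>\<^sup>2\<close> suffices
  to pass to the limit.\<close>
lemma integral_xi_dv:
  assumes T: "0 < T"
  shows "(\<lambda>t. \<xi> t \<bullet> dv t) integrable_on {0..T}"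
    and "- P 0 \<le> integral {0..T} (\<lambda>t. \<xi> t \<bullet> dv t)"
proof -
  have dvF: "(\<lambda>t. dv t \<bullet> F t) integrable_on {0..T}"
    by (rule integrable_inner_dv[OF T cont_F[OF T]])
  have "(\<lambda>t. - ((norm (dv t))\<^sup>2 + dv t \<bullet> F t)) integrable_on {0..T}"
    by (intro integrable_neg integrable_add dv_sq T dvF)
  then show xi_dv: "(\<lambda>t. \<xi> t \<bullet> dv t) integrable_on {0..T}"
    by (rule integrable_eq)
      (simp add: \<xi>_def inner_add_left inner_diff_left inner_diff_right dot_square_norm inner_commute)
  have "(\<lambda>t. (norm (dv t))\<^sup>2 + 2 * (dv t \<bullet> F t) + (norm (F t))\<^sup>2) integrable_on {0..T}"
    by (intro integrable_add integrable_on_mult_right dv_sq T dvF integrable_continuous_real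
        continuous_intros cont_F)
  then have xi_sq: "(\<lambda>t. (norm (\<xi> t))\<^sup>2) integrable_on {0..T}"
    by (rule integrable_eq)
      (simp add: \<xi>_def power2_norm_eq_inner inner_add_left inner_add_right inner_diff_left inner_diff_right inner_commute)
  \<comment> \<open>Positive steps tending to 0 that never exceed \<open>T\<close>, as the
    telescoping of backward differences requires.\<close>
  define h where "h n = T / real (Suc n)" for n
  have h: "0 < h n" "h n \<le> T" for n
    using T by (auto simp: h_def divide_le_eq mult_le_cancel_left1)
  have h_lim: "filterlim (\<lambda>n. - h n) (at 0) sequentially"
  proof -
    have "(\<lambda>n. T * inverse (real (Suc n))) \<longlonglongrightarrow> T * 0"
      by (intro tendsto_intros LIMSEQ_inverse_real_of_nat)
    then have "h \<longlonglongrightarrow> 0"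
      by (simp add: h_def[abs_def] divide_inverse)
    then have "(\<lambda>n. - h n) \<longlonglongrightarrow> 0"
      by (rule tendsto_minus[of h 0, simplified])
    moreover have "- h n \<noteq> 0" for n using h(1)[of n] by simp
    ultimately show ?thesis
      by (simp add: filterlim_at)
  qed
  define q where "q n t = (V t - V (t - h n)) /\<^sub>R h n" for n t
  \<comment> \<open>Expand the square of \<open>norm (\<xi> t - q n t)\<close>, bound the square of
    \<open>q\<close> by the increment of \<open>M\<close> and the mixed term by the increment of
    \<open>P\<close>. The result telescopes under the integral.\<close>
  define b where "b n t = (norm (\<xi> t))\<^sup>2 + (M t - M (t - h n)) / h n - 2 * ((P t - P (t - h n)) / h n)" for n t
  define A where "A = integral {0..T} (\<lambda>t. (norm (\<xi> t))\<^sup>2)"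
  have M_int: "M integrable_on {c..d}" for c d
    using M_mono by (intro integrable_on_mono_on) (auto simp: mono_on_def monoD)
  have b_int: "(b n has_integral (A + (integral {T-h n..T} M - integral {-h n..0} M) / h n
      - 2 * ((integral {T-h n..T} P - integral {-h n..0} P) / h n))) {0..T}" for n
    unfolding b_def A_def
    using h[of n]
    by (intro has_integral_add has_integral_diff has_integral_mult_right has_integral_divide
        integrable_integral xi_sq has_integral_backward_difference M_int integrable_P T) auto
  \<comment> \<open>On the right strip \<open>M\<close> is at most \<open>M T\<close> and
    \<open>P\<close> is nonnegative; on the left strip \<open>M\<close> vanishes and
    \<open>P\<close> equals \<open>P 0\<close>.\<close>
  have b_le: "integral {0..T} (b n) \<le> A + M T + 2 * P 0" for n
  proof -
    have "integral {T-h n..T} M \<le> integral {T-h n..T} (\<lambda>_. M T)"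
      using monoD[OF M_mono] by (intro integral_le M_int) auto
    then have "integral {T-h n..T} M \<le> h n * M T" using h[of n] by simp
    moreover have "integral {-h n..0} M = integral {-h n..0} (\<lambda>_. 0)"
      by (rule integral_cong) (simp add: M_neg)
    ultimately have "(integral {T-h n..T} M - integral {-h n..0} M) / h n \<le> M T"
      using h[of n] by (simp add: divide_le_eq mult.commute)
    moreover have "0 \<le> integral {T-h n..T} P"
      using h[of n] by (intro integral_nonneg integrable_on_subinterval[OF integrable_P[OF T, of 0]] P_nonneg) auto
    moreover have "integral {-h n..0} P = integral {-h n..0} (\<lambda>_. P 0)"
      by (rule integral_cong) (metis P_neg atLeastAtMost_iff)
    ultimately have "(integral {T-h n..T} M - integral {-h n..0} M) / h n \<le> M T"
      "- P 0 \<le> (integral {T-h n..T} P - integral {-h n..0} P) / h n"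
      using h[of n] by (simp_all add: le_divide_eq mult.commute)
    then show ?thesis unfolding integral_unique[OF b_int[of n]] by linarith
  qed
  \<comment> \<open>The translates of \<open>N\<close> are removed so that \<open>t\<close> and
    \<open>t - h n\<close> avoid \<open>N\<close> simultaneously, for all \<open>n\<close>.\<close>
  define Z where "Z = N \<union> {0} \<union> (\<Union>n. (+) (h n) ` N)"
  have Z: "negligible Z"
    unfolding Z_def by (intro negligible_Un N negligible_sing negligible_countable_Union)
      (auto intro: negligible_translation[OF N])
  have expand: "(norm (\<xi> t - p))\<^sup>2 = (norm (\<xi> t))\<^sup>2 + (norm p)\<^sup>2 - 2 * (\<xi> t \<bullet> p)" for t p
    by (simp add: power2_norm_eq_inner inner_diff_left inner_diff_right inner_commute)
  \<comment> \<open>The terms \<open>A + M T\<close> also occur in the bound on the majorants, so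
    they cancel and leave only the mixed term against \<open>P 0\<close>.\<close>
  have lim_int: "((\<lambda>t. (norm (\<xi> t - dv t))\<^sup>2) has_integral
      (A + M T - 2 * integral {0..T} (\<lambda>t. \<xi> t \<bullet> dv t))) {0..T}"
    unfolding expand A_def M_def
    by (intro has_integral_add has_integral_diff has_integral_mult_right integrable_integral
        xi_sq xi_dv dv_sq T)
  have "integral {0..T} (\<lambda>t. (norm (\<xi> t - dv t))\<^sup>2) \<le> A + M T + 2 * P 0"
  proof (rule Fatou_majorants)
    show "(\<lambda>t. (norm (\<xi> t - dv t))\<^sup>2) integrable_on {0..T}" using lim_int by blast
    show "b n integrable_on {0..T}" for n using b_int by blast
    show "integral {0..T} (b n) \<le> A + M T + 2 * P 0" for n by (rule b_le)
    show "negligible Z" by (rule Z)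
    show "0 \<le> (norm (\<xi> t - q n t))\<^sup>2 \<and> (norm (\<xi> t - q n t))\<^sup>2 \<le> b n t" if t: "t \<in> {0..T} - Z" for n t
    proof -
      have t': "0 < t" "t \<notin> N"
        using t by (auto simp: Z_def)
      have "h n + (t - h n) \<in> (+) (h n) ` N" if "t - h n \<in> N"
        using that by (rule imageI)
      then have t'': "t - h n \<notin> N"
        using t by (auto simp: Z_def)
      have "(norm (q n t))\<^sup>2 = (norm (V t - V (t - h n)))\<^sup>2 / (h n)\<^sup>2"
        using h[of n] by (simp add: q_def power_mult_distrib power_inverse divide_inverse_commute)
      also have "\<dots> \<le> h n * (M t - M (t - h n)) / (h n)\<^sup>2"
        using t' h[of n] by (intro divide_right_mono increment_bound_V) auto
      also have "\<dots> = (M t - M (t - h n)) / h n"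
        using h[of n] by (simp add: power2_eq_square)
      finally have "(norm (q n t))\<^sup>2 \<le> (M t - M (t - h n)) / h n" .
      moreover have "(P t - P (t - h n)) / h n \<le> \<xi> t \<bullet> q n t"
      proof -
        have "P t - P (t - h n) \<le> \<xi> t \<bullet> (V t - V (t - h n))"
          using subgradient_P[of t "t - h n"] t' t'' by (simp add: inner_diff_right)
        then show ?thesis
          using h[of n] by (simp add: q_def divide_inverse_commute mult_left_mono)
      qed
      ultimately have "(norm (\<xi> t - q n t))\<^sup>2 \<le> b n t"
        unfolding expand b_def by linarith
      then show ?thesis by simp
    qed
    show "(\<lambda>n. (norm (\<xi> t - q n t))\<^sup>2) \<longlonglongrightarrow> (norm (\<xi> t - dv t))\<^sup>2" if t: "t \<in> {0..T} - Z" for t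
    proof -
      have "(V has_vector_derivative dv t) (at t)"
        using t by (intro V_deriv) (auto simp: Z_def)
      from filterlim_compose[OF has_vector_derivative_quotient[OF this] h_lim]
      have "(\<lambda>n. (V (t + - h n) - V t) /\<^sub>R (- h n)) \<longlonglongrightarrow> dv t" .
      moreover have "(V (t + - h n) - V t) /\<^sub>R (- h n) = q n t" for n
        by (simp add: q_def scaleR_diff_right)
      ultimately have "(\<lambda>n. q n t) \<longlonglongrightarrow> dv t" by simp
      then show ?thesis by (intro tendsto_intros)
    qed
  qed
  then show "- P 0 \<le> integral {0..T} (\<lambda>t. \<xi> t \<bullet> dv t)"
    using integral_unique[OF lim_int] by simp
qed

end


subsection \<open>Energy estimate\<close>

lemma gradient_bound_imp_lipschitz:
  fixes f :: "'a::real_inner \<Rightarrow> real"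
  assumes grad: "\<And>z. GDERIV f z :> g z" and K: "\<And>z. norm z \<le> R \<Longrightarrow> norm (g z) \<le> K"
    and "norm a \<le> R" "norm b \<le> R"
  shows "norm (f b - f a) \<le> K * norm (b - a)"
proof (rule differentiable_bound[of "cball 0 R"])
  fix z assume z: "z \<in> cball (0 :: 'a) R"
  show "(f has_derivative (\<lambda>h. h \<bullet> g z)) (at z within cball 0 R)"
    using grad[of z] unfolding gderiv_def by (rule has_derivative_at_withinI)
  show "onorm (\<lambda>h. h \<bullet> g z) \<le> K"
  proof (rule onorm_bound)
    show "0 \<le> K" using K[of z] z norm_ge_zero[of "g z"] by (simp del: norm_ge_zero)
    fix h
    have "norm (h \<bullet> g z) \<le> norm h * norm (g z)" by (simp add: Cauchy_Schwarz_ineq2)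
    also have "\<dots> \<le> norm h * K" using K[of z] z by (intro mult_left_mono) auto
    finally show "norm (h \<bullet> g z) \<le> K * norm h" by (simp add: mult.commute)
  qed
qed (use assms in auto)

context dissipative_trajectory
begin

text \<open>The extra weight \<open>\<beta> * \<gamma>\<close> accounts for the friction term
  \<open>\<gamma> *\<^sub>R v\<close> paired with \<open>\<beta> *\<^sub>R dv\<close>, which is an
  exact derivative.\<close>

definition E :: "real \<Rightarrow> real" where "E t = (1 + \<beta> * \<gamma>) / 2 * (norm (v t))\<^sup>2 + f (y t)"
definition J :: "real \<Rightarrow> real" where "J t = integral {0..t} (\<lambda>s. norm (v s))"
text \<open>The initial energy above the level \<open>m\<close>, enlarged by the boundary term that
  the chain rule inequality costs.\<close>

definition C :: real where "C = E 0 + \<beta> * P 0 - m"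

lemma bounded_on_interval:
  assumes "0 < T"
  obtains R where "R > 0" "\<And>t. t \<in> {0..T} \<Longrightarrow> norm (x t) \<le> R" "\<And>t. t \<in> {0..T} \<Longrightarrow> norm (v t) \<le> R"
proof -
  have "bounded (x ` {0..T} \<union> v ` {0..T})"
    using assms by (intro compact_imp_bounded compact_Un compact_continuous_image cont_x cont_v) auto
  then obtain R where "R > 0" "\<forall>z \<in> x ` {0..T} \<union> v ` {0..T}. norm z \<le> R"
    unfolding bounded_pos by blast
  then show thesis by (intro that[of R]) auto
qed

text \<open>The centre \<open>e\<close> is 0 in the energy and decay estimates and a test point in
  the stationarity argument. Absolute continuity passes to the square because \<open>v\<close> is
  bounded on compact intervals.\<close>

lemma square_FTC:
  assumes "0 \<le> s" "s \<le> t"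
  shows "((\<lambda>\<tau>. 2 * (dv \<tau> \<bullet> (v \<tau> - e))) has_integral ((norm (v t - e))\<^sup>2 - (norm (v s - e))\<^sup>2)) {s..t}"
proof (rule abs_cont_on_fundamental_theorem[OF assms(2) _ N])
  have t1: "0 < t + 1" using assms by simp
  obtain R where R: "R > 0" "\<And>\<tau>. \<tau> \<in> {0..t+1} \<Longrightarrow> norm (v \<tau>) \<le> R"
    using bounded_on_interval[OF t1] by metis
  have "norm ((norm (v b - e))\<^sup>2 - (norm (v a - e))\<^sup>2)
      \<le> (2 * R + 2 * norm e) * (norm (v b - v a) + norm (v b - v a))"
    if ab: "a \<in> {0..t+1}" "b \<in> {0..t+1}" for a b
  proof -
    have "(norm (v b - e))\<^sup>2 - (norm (v a - e))\<^sup>2 = (v b - v a) \<bullet> ((v b - e) + (v a - e))"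
      by (simp add: power2_norm_eq_inner inner_diff_left inner_diff_right inner_add_right inner_commute)
    then have "norm ((norm (v b - e))\<^sup>2 - (norm (v a - e))\<^sup>2)
        \<le> norm (v b - v a) * norm ((v b - e) + (v a - e))"
      by (simp add: Cauchy_Schwarz_ineq2)
    also have "\<dots> \<le> norm (v b - v a) * (2 * R + 2 * norm e)"
    proof (rule mult_left_mono)
      have "norm ((v b - e) + (v a - e)) \<le> (norm (v b) + norm e) + (norm (v a) + norm e)"
        by (intro norm_triangle_le add_mono norm_triangle_ineq4)
      then show "norm ((v b - e) + (v a - e)) \<le> 2 * R + 2 * norm e"
        using R(2)[OF ab(1)] R(2)[OF ab(2)] by simp
    qed simp
    also have "\<dots> \<le> (2 * R + 2 * norm e) * (norm (v b - v a) + norm (v b - v a))"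
      using R(1) by (subst mult.commute) (intro mult_left_mono, auto)
    finally show ?thesis .
  qed
  then have "abs_cont_on {0..t+1} (\<lambda>\<tau>. (norm (v \<tau> - e))\<^sup>2)"
    by (rule abs_cont_on_dominated[OF ac_v[OF t1] ac_v[OF t1]])
  then show "abs_cont_on {s..t} (\<lambda>\<tau>. (norm (v \<tau> - e))\<^sup>2)"
    by (rule abs_cont_on_subset) (use assms in auto)
  fix \<tau> assume \<tau>: "s < \<tau>" "\<tau> < t" "\<tau> \<notin> N"
  have "((\<lambda>\<tau>. v \<tau> - e) has_vector_derivative dv \<tau> - 0) (at \<tau>)"
    using \<tau> assms by (intro has_vector_derivative_diff v_deriv has_vector_derivative_const) auto
  from bounded_bilinear.has_vector_derivative[OF bounded_bilinear_inner this this]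
  show "((\<lambda>\<tau>. (norm (v \<tau> - e))\<^sup>2) has_vector_derivative 2 * (dv \<tau> \<bullet> (v \<tau> - e))) (at \<tau>)"
    by (simp add: power2_norm_eq_inner inner_commute)
qed

text \<open>On \<open>[0, T]\<close> the curve \<open>y\<close> stays in a ball on which
  \<open>f\<close> is Lipschitz, so \<open>f (y t)\<close> is absolutely continuous; the chain rule
  gives its derivative off \<open>N\<close>.\<close>

lemma f_y_FTC:
  assumes T: "0 < T"
  shows "((\<lambda>t. (v t + \<beta> *\<^sub>R dv t) \<bullet> g (y t)) has_integral (f (y T) - f (y 0))) {0..T}"
proof (rule abs_cont_on_fundamental_theorem[OF _ _ N])
  show "0 \<le> T" using T by simp
  obtain R where R: "R > 0" "\<And>t. t \<in> {0..T} \<Longrightarrow> norm (x t) \<le> R" "\<And>t. t \<in> {0..T} \<Longrightarrow> norm (v t) \<le> R"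
    using bounded_on_interval[OF T] by metis
  obtain K where K: "\<And>z. norm z \<le> (1 + \<beta>) * R \<Longrightarrow> norm (g z) \<le> K"
    using g_bounded[of "(1 + \<beta>) * R"] by metis
  have "norm (g 0) \<le> K" using R(1) beta by (intro K) simp
  then have K0: "0 \<le> K" using norm_ge_zero[of "g 0"] by linarith
  have y: "norm (y t) \<le> (1 + \<beta>) * R" if "t \<in> {0..T}" for t
  proof -
    have "norm (y t) \<le> norm (x t) + \<beta> * norm (v t)"
      unfolding y_def using norm_triangle_ineq[of "x t" "\<beta> *\<^sub>R v t"] beta by simp
    also have "\<dots> \<le> R + \<beta> * R" using R that beta by (intro add_mono mult_left_mono) auto
    finally show ?thesis by (simp add: algebra_simps)
  qed
  have "norm (f (y b) - f (y a)) \<le> (K * (1 + \<beta>)) * (norm (x b - x a) + norm (v b - v a))"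
    if ab: "a \<in> {0..T}" "b \<in> {0..T}" for a b
  proof -
    have "norm (f (y b) - f (y a)) \<le> K * norm (y b - y a)"
      by (rule gradient_bound_imp_lipschitz[OF grad K y[OF ab(1)] y[OF ab(2)]])
    also have "norm (y b - y a) \<le> norm (x b - x a) + \<beta> * norm (v b - v a)"
    proof -
      have "y b - y a = (x b - x a) + \<beta> *\<^sub>R (v b - v a)" by (simp add: y_def algebra_simps)
      then show ?thesis using norm_triangle_ineq[of "x b - x a" "\<beta> *\<^sub>R (v b - v a)"] beta by simp
    qed
    also have "norm (x b - x a) + \<beta> * norm (v b - v a) \<le> (1 + \<beta>) * (norm (x b - x a) + norm (v b - v a))"
      using beta mult_nonneg_nonneg[OF beta norm_ge_zero[of "x b - x a"]] by (simp add: algebra_simps)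
    finally show ?thesis using K0 by (simp add: mult_left_mono mult.assoc)
  qed
  then show "abs_cont_on {0..T} (\<lambda>t. f (y t))"
    by (rule abs_cont_on_dominated[OF ac_x[OF T] ac_v[OF T]])
  fix t assume t: "0 < t" "t < T" "t \<notin> N"
  have "(y has_vector_derivative v t + \<beta> *\<^sub>R dv t) (at t)"
    unfolding y_def[abs_def]
    by (intro has_vector_derivative_add x_deriv t bounded_linear.has_vector_derivative[OF bounded_linear_scaleR_right] v_deriv)
  then have "(y has_derivative (\<lambda>h. h *\<^sub>R (v t + \<beta> *\<^sub>R dv t))) (at t)"
    by (simp add: has_vector_derivative_def)
  from has_derivative_compose[OF this grad[unfolded gderiv_def]]
  show "((\<lambda>t. f (y t)) has_vector_derivative (v t + \<beta> *\<^sub>R dv t) \<bullet> g (y t)) (at t)"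
    by (simp add: has_vector_derivative_def)
qed

lemma integrable_norm_v: "0 \<le> s \<Longrightarrow> (\<lambda>t. norm (v t)) integrable_on {s..t}"
  by (rule integrable_on_subinterval[of _ "{0..\<bar>t\<bar> + 1}"])
    (auto intro!: integrable_continuous_real continuous_intros cont_v)

text \<open>Testing the inclusion with \<open>v + \<beta> v'\<close> makes the gradient term an exact derivative.\<close>
lemma energy:
  assumes T: "0 < T"
  shows "E T + r * J T \<le> E 0 + \<beta> * P 0"
proof -
  have "((\<lambda>t. (1 + \<beta> * \<gamma>) / 2 * (2 * (dv t \<bullet> (v t - 0))) + (v t + \<beta> *\<^sub>R dv t) \<bullet> g (y t)) has_integral
      ((1 + \<beta> * \<gamma>) / 2 * ((norm (v T - 0))\<^sup>2 - (norm (v 0 - 0))\<^sup>2) + (f (y T) - f (y 0)))) {0..T}"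
    using T by (intro has_integral_add has_integral_mult_right square_FTC f_y_FTC) auto
  moreover have "((\<lambda>t. - (r * norm (v t)) - \<beta> * (\<xi> t \<bullet> dv t)) has_integral
      (- (r * J T) - \<beta> * integral {0..T} (\<lambda>t. \<xi> t \<bullet> dv t))) {0..T}"
    unfolding J_def
    by (intro has_integral_diff has_integral_neg has_integral_mult_right integrable_integral
        integrable_norm_v integral_xi_dv T order_refl)
  moreover have "negligible (N \<union> {0})" by (intro negligible_Un N negligible_sing)
  moreover have "(1 + \<beta> * \<gamma>) / 2 * (2 * (dv t \<bullet> (v t - 0))) + (v t + \<beta> *\<^sub>R dv t) \<bullet> g (y t)
      \<le> - (r * norm (v t)) - \<beta> * (\<xi> t \<bullet> dv t)" if "t \<in> {0..T} - (N \<union> {0})" for t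
  proof -
    \<comment> \<open>After this substitution all terms in \<open>v t \<bullet> dv t\<close> cancel,
      thanks to the weight in \<open>E\<close>.\<close>
    have g: "g (y t) = - \<xi> t - dv t - \<gamma> *\<^sub>R v t" by (simp add: \<xi>_def F_def)
    have "(1 + \<beta> * \<gamma>) / 2 * (2 * (dv t \<bullet> (v t - 0))) + (v t + \<beta> *\<^sub>R dv t) \<bullet> g (y t)
      = - (\<xi> t \<bullet> v t) - \<beta> * (\<xi> t \<bullet> dv t) - \<gamma> * (v t \<bullet> v t) - \<beta> * (dv t \<bullet> dv t)"
      unfolding g
      by (simp add: inner_add_left inner_diff_right inner_commute algebra_simps)
    moreover have "0 \<le> \<gamma> * (v t \<bullet> v t)" "0 \<le> \<beta> * (dv t \<bullet> dv t)" using gamma beta by auto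
    moreover have "r * norm (v t) \<le> \<xi> t \<bullet> v t" using that by (intro xi_v_ge) auto
    ultimately show ?thesis by linarith
  qed
  ultimately have "(1 + \<beta> * \<gamma>) / 2 * ((norm (v T - 0))\<^sup>2 - (norm (v 0 - 0))\<^sup>2) + (f (y T) - f (y 0))
    \<le> - (r * J T) - \<beta> * integral {0..T} (\<lambda>t. \<xi> t \<bullet> dv t)"
    by (rule has_integral_le_AE)
  moreover have "\<beta> * (- P 0) \<le> \<beta> * integral {0..T} (\<lambda>t. \<xi> t \<bullet> dv t)"
    by (rule mult_left_mono[OF integral_xi_dv(2)[OF T] beta])
  ultimately show ?thesis by (simp add: E_def algebra_simps)
qed

section \<open>Bounds on length, speed and displacement\<close>

lemma J_bound: "0 < T \<Longrightarrow> r * J T \<le> C"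
  using energy[of T] f_lower[of "y T"] beta gamma unfolding C_def E_def
  by (smt (verit) divide_nonneg_nonneg mult_nonneg_nonneg zero_le_power2)

lemma J_diff: "J t - J s = integral {s..t} (\<lambda>\<tau>. norm (v \<tau>))" if "0 \<le> s" "s \<le> t"
  using Henstock_Kurzweil_Integration.integral_combine[OF that integrable_norm_v[of 0]]
  by (simp add: J_def)

lemma J_mono: "0 \<le> s \<Longrightarrow> s \<le> t \<Longrightarrow> J s \<le> J t"
  using J_diff[of s t] integral_nonneg[OF integrable_norm_v[of s t]] by simp

text \<open>Of the energy inequality only the kinetic part with weight 1/2 is kept; the rest is
  nonnegative once \<open>m\<close> is subtracted.\<close>

lemma v_bound: "(norm (v t))\<^sup>2 \<le> 2 * C" if "0 < t"
proof -
  have "0 \<le> r * J t"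
    using r_pos J_mono[of 0 t] that by (simp add: J_def)
  moreover have "0 \<le> \<beta> * \<gamma> / 2 * (norm (v t))\<^sup>2" using beta gamma by simp
  ultimately show ?thesis
    using energy[OF that] f_lower[of "y t"] by (simp add: C_def E_def algebra_simps add_divide_distrib)
qed

text \<open>Testing with \<open>e = x t - x s\<close> bounds the square of \<open>norm e\<close> by
  \<open>(J t - J s) * norm e\<close>, and one factor is divided out.\<close>

lemma increment_x: "norm (x t - x s) \<le> J t - J s" if "0 \<le> s" "s \<le> t"
proof (cases "x t = x s")
  case False
  define e where "e = x t - x s"
  have "(norm e)\<^sup>2 \<le> integral {s..t} (\<lambda>\<tau>. norm (v \<tau>)) * norm e"
  proof (rule has_integral_le)
    show "((\<lambda>\<tau>. v \<tau> \<bullet> e) has_integral (norm e)\<^sup>2) {s..t}"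
      using inner_FTC(2)[OF that, of e] by (simp add: e_def dot_square_norm)
    show "((\<lambda>\<tau>. norm (v \<tau>) * norm e) has_integral integral {s..t} (\<lambda>\<tau>. norm (v \<tau>)) * norm e) {s..t}"
      using that by (intro has_integral_mult_left integrable_integral integrable_norm_v)
  qed (rule norm_cauchy_schwarz)
  then show ?thesis
    using False J_diff[OF that] by (simp add: e_def power2_eq_square)
qed (use J_mono that in simp)

end


subsection \<open>Convergence\<close>

context dissipative_trajectory
begin

text \<open>Monotone convergence for the truncations to \<open>[0, n]\<close>, whose integrals the
  energy estimate bounds by \<open>C / r\<close>.\<close>

lemma integrable_norm_v_half_line:
  "(\<lambda>t. norm (v t)) integrable_on {0..}"
  "(\<lambda>n. J (real n)) \<longlonglongrightarrow> integral {0..} (\<lambda>t. norm (v t))"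
proof -
  define w where "w n t = (if t \<in> {0..real n} then norm (v t) else 0)" for n t
  have w_int: "(w n has_integral J (real n)) {0..}" for n
  proof -
    have "((\<lambda>t. norm (v t)) has_integral J (real n)) {0..real n}"
      unfolding J_def by (intro integrable_integral integrable_norm_v) simp
    then show ?thesis
      unfolding w_def by (subst has_integral_restrict) auto
  qed
  have "(\<lambda>t. norm (v t)) integrable_on {0..} \<and>
    (\<lambda>n. integral {0..} (w n)) \<longlonglongrightarrow> integral {0..} (\<lambda>t. norm (v t))"
  proof (rule monotone_convergence_increasing)
    show "w n integrable_on {0..}" for n using w_int by blast
    show "w n t \<le> w (Suc n) t" if "t \<in> {0..}" for n t by (simp add: w_def)
    show "(\<lambda>n. w n t) \<longlonglongrightarrow> norm (v t)" if "t \<in> {0..}" for t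
    proof (rule tendsto_eventually)
      obtain k where "t \<le> real k" using real_arch_simple by blast
      then show "\<forall>\<^sub>F n in sequentially. w n t = norm (v t)"
        using that by (intro eventually_sequentiallyI[of k]) (auto simp: w_def)
    qed
    have "\<bar>J (real n)\<bar> \<le> C / r" for n
    proof -
      \<comment> \<open>\<open>J_bound\<close> asks for a positive time; the shift by 1 includes
        \<open>n = 0\<close>.\<close>
      have "J (real n) \<le> J (real n + 1)" by (rule J_mono) auto
      moreover have "r * J (real n + 1) \<le> C" by (rule J_bound) simp
      moreover have "0 \<le> J (real n)" using J_mono[of 0 "real n"] by (simp add: J_def)
      ultimately show ?thesis
        using r_pos by (smt (verit) mult.commute pos_le_divide_eq)
    qed
    then show "bounded (range (\<lambda>n. integral {0..} (w n)))"
      using integral_unique[OF w_int] by (auto simp: bounded_iff)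
  qed
  then show "(\<lambda>t. norm (v t)) integrable_on {0..}"
    "(\<lambda>n. J (real n)) \<longlonglongrightarrow> integral {0..} (\<lambda>t. norm (v t))"
    using integral_unique[OF w_int] by auto
qed

text \<open>\<open>v\<close> is arbitrary at negative times. Under the indicator it may be replaced
  by the continuous \<open>V\<close>, which gives Borel measurability and hence integrability for
  \<open>lborel\<close>.\<close>

lemma set_integrable_norm_v: "set_integrable lborel {0..} (\<lambda>t. norm (v t))"
proof -
  have "(\<lambda>t. norm (v t)) absolutely_integrable_on {0..}"
    using integrable_norm_v_half_line(1) by (intro nonnegative_absolutely_integrable_1) auto
  then have "integrable lebesgue (\<lambda>t. indicator {0..} t *\<^sub>R norm (v t))"
    by (simp add: set_integrable_def)
  also have "(\<lambda>t. indicator {0..} t *\<^sub>R norm (v t)) = (\<lambda>t. indicator {0..} t *\<^sub>R norm (V t))"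
    by (auto simp: indicator_def)
  finally have "integrable lborel (\<lambda>t. indicator {0..} t *\<^sub>R norm (V t))"
  proof (subst (asm) integrable_completion)
    have "(\<lambda>t. norm (V t)) \<in> borel_measurable borel"
      by (intro borel_measurable_continuous_onI continuous_intros cont_V)
    then show "(\<lambda>t. indicator {0..} t *\<^sub>R norm (V t)) \<in> borel_measurable lborel"
      by (intro borel_measurable_scaleR) auto
  qed
  also have "(\<lambda>t. indicator {0..} t *\<^sub>R norm (V t)) = (\<lambda>t. indicator {0..} t *\<^sub>R norm (v t))"
    by (auto simp: indicator_def)
  finally show ?thesis by (simp add: set_integrable_def)
qed

section \<open>The length remaining after a given time\<close>

lemma J_diff_le_tail:
  assumes "0 \<le> s" "s \<le> t"
  shows "J t - J s \<le> (LBINT \<tau>:{s..}. norm (v \<tau>))"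
proof -
  have "set_integrable lborel {s..} (\<lambda>t. norm (v t))"
    by (rule set_integrable_subset[OF set_integrable_norm_v]) (use assms in auto)
  note tail = set_borel_integral_eq_integral[OF this]
  show ?thesis
    unfolding tail(2) J_diff[OF assms]
    by (rule integral_subset_le) (use assms integrable_norm_v tail(1) in auto)
qed

lemma J_tendsto: "(J \<longlongrightarrow> (LBINT \<tau>:{0..}. norm (v \<tau>))) at_top"
proof -
  have "((\<lambda>t. LBINT \<tau>:{0..t}. norm (v \<tau>)) \<longlongrightarrow> (LBINT \<tau>:{0..}. norm (v \<tau>))) at_top"
    by (rule tendsto_set_lebesgue_integral_at_top[OF _ set_integrable_norm_v]) simp
  moreover have "(LBINT \<tau>:{0..t}. norm (v \<tau>)) = J t" for t
    unfolding J_def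
    by (rule set_borel_integral_eq_integral(2)[OF set_integrable_subset[OF set_integrable_norm_v]]) auto
  ultimately show ?thesis by simp
qed

lemma J_le: "0 \<le> t \<Longrightarrow> J t \<le> (LBINT \<tau>:{0..}. norm (v \<tau>))"
  using J_diff_le_tail[of 0 t] by (simp add: J_def)

definition tail :: "real \<Rightarrow> real" where "tail t = (LBINT \<tau>:{0..}. norm (v \<tau>)) - J t"

lemma tail_tendsto: "(tail \<longlongrightarrow> 0) at_top"
  unfolding tail_def using tendsto_diff[OF tendsto_const J_tendsto, of "LBINT \<tau>:{0..}. norm (v \<tau>)"] by simp

lemma J_diff_le: "0 \<le> t \<Longrightarrow> J t - J s \<le> tail s"
  using J_le[of t] by (simp add: tail_def)

text \<open>Increments of \<open>x\<close> are dominated by those of the convergent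
  \<open>J\<close>, so \<open>x\<close> is Cauchy along the integers; completeness gives the limit,
  and the domination extends it to all times.\<close>

lemma trajectory_converges:
  obtains xinf where "(x \<longlongrightarrow> xinf) at_top"
    "\<And>t. 0 \<le> t \<Longrightarrow> norm (x t - xinf) \<le> (LBINT s:{t..}. norm (v s))"
proof -
  have "Cauchy (\<lambda>n. J (real n))"
    using integrable_norm_v_half_line(2) by (intro LIMSEQ_imp_Cauchy)
  have inc: "norm (x (real m) - x (real n)) \<le> norm (J (real m) - J (real n))" for m n
    using increment_x[of "real n" "real m"] increment_x[of "real m" "real n"]
    by (cases "n \<le> m") (auto simp: norm_minus_commute)
  have "Cauchy (\<lambda>n. x (real n))"
  proof (rule CauchyI)
    fix e :: real assume "0 < e"
    from CauchyD[OF \<open>Cauchy (\<lambda>n. J (real n))\<close> this]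
    show "\<exists>M. \<forall>m\<ge>M. \<forall>n\<ge>M. norm (x (real m) - x (real n)) < e"
      using inc le_less_trans by meson
  qed
  then obtain xinf where lim: "(\<lambda>n. x (real n)) \<longlonglongrightarrow> xinf"
    using Cauchy_convergent convergent_def by metis
  \<comment> \<open>Stated for any bound \<open>B\<close> on the remaining length:
    \<open>tail t\<close> yields convergence, the integral over \<open>{t..}\<close> the final
    estimate.\<close>
  have bound: "norm (x t - xinf) \<le> B" if "0 \<le> t" "\<And>s. t \<le> s \<Longrightarrow> J s - J t \<le> B" for t B
  proof (rule LIMSEQ_le_const2)
    show "(\<lambda>n. norm (x t - x (real n))) \<longlonglongrightarrow> norm (x t - xinf)"
      by (intro tendsto_intros lim)
    obtain k where k: "t \<le> real k" using real_arch_simple by blast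
    have "norm (x t - x (real n)) \<le> B" if "k \<le> n" for n
    proof -
      have "t \<le> real n" using k that by simp
      then show ?thesis
        using increment_x[OF \<open>0 \<le> t\<close>, of "real n"] \<open>\<And>s. t \<le> s \<Longrightarrow> J s - J t \<le> B\<close>[of "real n"]
        by (simp add: norm_minus_commute)
    qed
    then show "\<exists>N. \<forall>n\<ge>N. norm (x t - x (real n)) \<le> B" by blast
  qed
  have "(x \<longlongrightarrow> xinf) at_top"
  proof (rule LIM_zero_cancel, rule Lim_null_comparison)
    show "\<forall>\<^sub>F t in at_top. norm (x t - xinf) \<le> tail t"
      using eventually_ge_at_top[of 0]
      by eventually_elim (rule bound, auto intro: J_diff_le)
    show "(tail \<longlongrightarrow> 0) at_top" by (rule tail_tendsto)
  qed
  moreover have "norm (x t - xinf) \<le> (LBINT s:{t..}. norm (v s))" if "0 \<le> t" for t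
    using that by (intro bound J_diff_le_tail)
  ultimately show thesis by (rule that)
qed

text \<open>Finite length makes \<open>v\<close> small at arbitrarily late times
  (\<open>small\<close>); after such a time \<open>s\<close> its square cannot grow by more than
  \<open>2 * K * tail s\<close> (\<open>growth\<close>).\<close>

lemma velocity_vanishes: "(v \<longlongrightarrow> 0) at_top"
proof -
  define L where "L = (LBINT \<tau>:{0..}. norm (v \<tau>))"
  \<comment> \<open>Bounds \<open>y\<close> at all positive times: \<open>x\<close> moves by at most
    the total length \<open>L\<close>, and the energy bounds the speed by
    \<open>sqrt (2 * C)\<close>.\<close>
  define B where "B = norm (x 0) + L + \<beta> * sqrt (2 * C)"
  obtain K where K: "\<And>z. norm z \<le> B \<Longrightarrow> norm (g z) \<le> K"
    using g_bounded[of B] by metis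
  have y_le: "norm (y t) \<le> B" if "0 < t" for t
  proof -
    have "norm (y t) \<le> norm (x t) + \<beta> * norm (v t)"
      unfolding y_def using norm_triangle_ineq[of "x t" "\<beta> *\<^sub>R v t"] beta by simp
    moreover have "norm (x t) \<le> norm (x 0) + L"
      using norm_triangle_ineq2[of "x t" "x 0"] increment_x[of 0 t] J_le[of t] that
      by (simp add: L_def J_def)
    moreover have "norm (v t) \<le> sqrt (2 * C)"
      using v_bound[OF that] by (rule real_le_rsqrt)
    then have "\<beta> * norm (v t) \<le> \<beta> * sqrt (2 * C)" using beta by (rule mult_left_mono)
    ultimately show ?thesis by (simp add: B_def)
  qed
  have K0: "0 \<le> K" using K[OF y_le[of 1]] norm_ge_zero[of "g (y 1)"] by linarith
  have growth: "(norm (v t))\<^sup>2 \<le> (norm (v s))\<^sup>2 + 2 * K * tail s" if st: "0 < s" "s \<le> t" for s t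
  proof -
    have "(norm (v t - 0))\<^sup>2 - (norm (v s - 0))\<^sup>2 \<le> 2 * K * integral {s..t} (\<lambda>\<tau>. norm (v \<tau>))"
    proof (rule has_integral_le_AE[OF square_FTC _ N])
      show "((\<lambda>\<tau>. 2 * K * norm (v \<tau>)) has_integral 2 * K * integral {s..t} (\<lambda>\<tau>. norm (v \<tau>))) {s..t}"
        using st by (intro has_integral_mult_right integrable_integral integrable_norm_v) simp
      show "2 * (dv \<tau> \<bullet> (v \<tau> - 0)) \<le> 2 * K * norm (v \<tau>)" if \<tau>: "\<tau> \<in> {s..t} - N" for \<tau>
      proof -
        have t0: "0 < \<tau>" "\<tau> \<notin> N" using \<tau> st by auto
        \<comment> \<open>Both friction terms have the favourable sign; only the gradient can
          accelerate.\<close>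
        have "dv \<tau> = - \<xi> \<tau> - \<gamma> *\<^sub>R v \<tau> - g (y \<tau>)" by (simp add: \<xi>_def F_def)
        then have "dv \<tau> \<bullet> v \<tau> = - (\<xi> \<tau> \<bullet> v \<tau>) - \<gamma> * (v \<tau> \<bullet> v \<tau>) - g (y \<tau>) \<bullet> v \<tau>"
          by (simp add: inner_diff_left)
        moreover have "0 \<le> \<xi> \<tau> \<bullet> v \<tau>"
          using P_le_xi_v[OF t0] P_nonneg[of \<tau>] by linarith
        moreover have "0 \<le> \<gamma> * (v \<tau> \<bullet> v \<tau>)" using gamma by simp
        moreover have "- (g (y \<tau>) \<bullet> v \<tau>) \<le> norm (g (y \<tau>)) * norm (v \<tau>)"
          using Cauchy_Schwarz_ineq2[of "g (y \<tau>)" "v \<tau>"] by linarith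
        moreover have "norm (g (y \<tau>)) * norm (v \<tau>) \<le> K * norm (v \<tau>)"
          by (intro mult_right_mono K y_le t0) simp
        ultimately show ?thesis by simp
      qed
    qed (use st in auto)
    moreover have "integral {s..t} (\<lambda>\<tau>. norm (v \<tau>)) \<le> tail s"
      using J_diff[of s t] J_diff_le[of t s] st by simp
    then have "2 * K * integral {s..t} (\<lambda>\<tau>. norm (v \<tau>)) \<le> 2 * K * tail s"
      using K0 by (intro mult_left_mono) auto
    ultimately show ?thesis by simp
  qed
  have small: "\<exists>s\<ge>S. norm (v s) < d" if "0 < d" "0 \<le> S" for S d
  proof (rule ccontr)
    assume "\<not> (\<exists>s\<ge>S. norm (v s) < d)"
    then have ge: "d \<le> norm (v s)" if "S \<le> s" for s using that by force
    \<comment> \<open>Speed at least \<open>d\<close> up to this time would cover length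
      \<open>L - J S + 1\<close>, one more than is left.\<close>
    define t where "t = S + (L - J S + 1) / d"
    have "0 \<le> L - J S" using J_le[OF \<open>0 \<le> S\<close>] by (simp add: L_def)
    then have "S \<le> t" using \<open>0 < d\<close> by (simp add: t_def)
    have "d * (t - S) = integral {S..t} (\<lambda>_. d)" using \<open>S \<le> t\<close> by simp
    also have "\<dots> \<le> integral {S..t} (\<lambda>\<tau>. norm (v \<tau>))"
      using ge \<open>0 \<le> S\<close> by (intro integral_le integrable_norm_v integrable_const_ivl) auto
    also have "\<dots> = J t - J S" using J_diff[OF \<open>0 \<le> S\<close> \<open>S \<le> t\<close>] by simp
    also have "\<dots> \<le> L - J S" using J_le[of t] \<open>0 \<le> S\<close> \<open>S \<le> t\<close> by (simp add: L_def)
    finally show False using \<open>0 < d\<close> by (simp add: t_def)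
  qed
  show ?thesis
  proof (rule tendstoI)
    fix e :: real assume "0 < e"
    have "((\<lambda>s. 2 * K * tail s) \<longlongrightarrow> 2 * K * 0) at_top"
      by (intro tendsto_intros tail_tendsto)
    then have "\<forall>\<^sub>F s in at_top. 2 * K * tail s < e\<^sup>2 / 2"
      using \<open>0 < e\<close> by (intro order_tendstoD(2)[of _ "2 * K * 0"]) auto
    then obtain S where S: "\<And>s. S \<le> s \<Longrightarrow> 2 * K * tail s < e\<^sup>2 / 2"
      unfolding eventually_at_top_linorder by blast
    \<comment> \<open>The 1 keeps \<open>s\<close> positive, as \<open>growth\<close> requires; the
      two contributions sum to three quarters of the square of \<open>e\<close>.\<close>
    obtain s where s: "max S 1 \<le> s" "norm (v s) < e / 2"
      using small[OF half_gt_zero[OF \<open>0 < e\<close>], of "max S 1"] by (auto simp: le_max_iff_disj)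
    have "dist (v t) 0 < e" if "s \<le> t" for t
    proof -
      have "(norm (v t))\<^sup>2 \<le> (norm (v s))\<^sup>2 + 2 * K * tail s"
        using s(1) that by (intro growth) auto
      also have "\<dots> < (e / 2)\<^sup>2 + e\<^sup>2 / 2"
      proof (rule add_strict_mono)
        show "(norm (v s))\<^sup>2 < (e / 2)\<^sup>2" using s(2) by (intro power_strict_mono) auto
        show "2 * K * tail s < e\<^sup>2 / 2" using s(1) by (intro S) simp
      qed
      also have "\<dots> \<le> e\<^sup>2" by (simp add: power_divide)
      finally have "norm (v t) < e" by (rule power2_less_imp_less) (use \<open>0 < e\<close> in simp)
      then show ?thesis by simp
    qed
    then show "\<forall>\<^sub>F t in at_top. dist (v t) 0 < e"
      unfolding eventually_at_top_linorder by blast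
  qed
qed

lemma y_converges: "(x \<longlongrightarrow> xinf) at_top \<Longrightarrow> (y \<longlongrightarrow> xinf) at_top"
  unfolding y_def[abs_def]
  using tendsto_add[OF _ tendsto_scaleR[OF tendsto_const velocity_vanishes], of x xinf \<beta>] by simp

text \<open>The subgradient inequality and \<open>P \<ge> 0\<close> give
  \<open>dv t \<bullet> (v t - w) \<le> c + F t \<bullet> (w - v t)\<close> off \<open>N\<close>.
  The right-hand side tends to \<open>c + g xinf \<bullet> w\<close>, which is negative if
  \<open>w\<close> violates the claim.\<close>

lemma limit_stationary:
  assumes x: "(x \<longlongrightarrow> xinf) at_top"
  shows "- g xinf \<in> subdifferential \<phi> 0"
proof -
  have "- (g xinf \<bullet> w) \<le> c" if w: "\<phi> w = ereal c" for w c
  proof (rule ccontr)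
    assume "\<not> - (g xinf \<bullet> w) \<le> c"
    \<comment> \<open>The limit equals \<open>-2 * d\<close>, so values below \<open>-d\<close> are
      eventually guaranteed.\<close>
    define d where "d = - (c + g xinf \<bullet> w) / 2"
    have d: "0 < d" using \<open>\<not> - (g xinf \<bullet> w) \<le> c\<close> by (simp add: d_def)
    have "isCont g xinf" using g_cont by (simp add: continuous_on_eq_continuous_at)
    then have "((\<lambda>t. g (y t)) \<longlongrightarrow> g xinf) at_top"
      by (rule isCont_tendsto_compose[OF _ y_converges[OF x]])
    then have "((\<lambda>t. c + F t \<bullet> (w - v t)) \<longlongrightarrow> c + (\<gamma> *\<^sub>R 0 + g xinf) \<bullet> (w - 0)) at_top"
      unfolding F_def by (intro tendsto_intros velocity_vanishes)
    moreover have "c + (\<gamma> *\<^sub>R 0 + g xinf) \<bullet> (w - 0) < - d"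
      using d by (simp add: d_def field_simps)
    ultimately have "\<forall>\<^sub>F t in at_top. c + F t \<bullet> (w - v t) < - d"
      by (rule order_tendstoD(2))
    then obtain S where S: "\<And>t. S \<le> t \<Longrightarrow> c + F t \<bullet> (w - v t) < - d"
      unfolding eventually_at_top_linorder by blast
    define s where "s = max S 1"
    \<comment> \<open>Decreasing at rate \<open>2 * d\<close> until this time would bring the
      squared distance to -1 or below.\<close>
    define t where "t = s + ((norm (v s - w))\<^sup>2 + 1) / (2 * d)"
    have st: "s \<le> t" "0 < s" using d by (auto simp: t_def s_def)
    have "(norm (v t - w))\<^sup>2 - (norm (v s - w))\<^sup>2 \<le> (t - s) * (- 2 * d)"
    proof (rule has_integral_le_AE[OF square_FTC _ N])
      show "((\<lambda>_. - 2 * d) has_integral (t - s) * (- 2 * d)) {s..t}"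
        using has_integral_const_real[of "- 2 * d" s t] st by simp
      show "2 * (dv \<tau> \<bullet> (v \<tau> - w)) \<le> - 2 * d" if \<tau>: "\<tau> \<in> {s..t} - N" for \<tau>
      proof -
        have t0: "0 < \<tau>" "\<tau> \<notin> N" "S \<le> \<tau>" using \<tau> st by (auto simp: s_def)
        have "dv \<tau> = - \<xi> \<tau> - F \<tau>" by (simp add: \<xi>_def)
        then have "dv \<tau> \<bullet> (v \<tau> - w) = \<xi> \<tau> \<bullet> (w - v \<tau>) + F \<tau> \<bullet> (w - v \<tau>)"
          by (simp add: inner_diff_left inner_diff_right)
        moreover have "P \<tau> + \<xi> \<tau> \<bullet> (w - v \<tau>) \<le> c"
          using subgradient[OF t0(1,2), of w] w by simp
        moreover note S[OF t0(3)] P_nonneg[of \<tau>]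
        ultimately show ?thesis by linarith
      qed
    qed (use st in auto)
    moreover have "(t - s) * (- 2 * d) = - ((norm (v s - w))\<^sup>2 + 1)"
      using d by (simp add: t_def)
    ultimately show False using zero_le_power2[of "norm (v t - w)"] by linarith
  qed
  \<comment> \<open>For infinite \<open>\<phi> w\<close> the inequality is trivial, since
    nonnegativity excludes the value \<open>-\<infinity>\<close>.\<close>
  then have "\<phi> 0 + ereal (- g xinf \<bullet> (w - 0)) \<le> \<phi> w" for w
    using phi_nonneg[of w] by (cases "\<phi> w") (auto simp: phi_0)
  then show ?thesis by (simp add: subdifferential_def phi_0)
qed

end


subsection \<open>Strong solutions\<close>

lemma lipschitz_on_bounded_imp_bounded:
  fixes g :: "'a::real_normed_vector \<Rightarrow> 'b::real_normed_vector"
  assumes "\<And>B. bounded B \<Longrightarrow> \<exists>L. L-lipschitz_on B g"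
  shows "\<exists>K. \<forall>z. norm z \<le> R \<longrightarrow> norm (g z) \<le> K"
proof -
  \<comment> \<open>The absolute value keeps the reference point 0 in the ball when \<open>R\<close>
    is negative.\<close>
  obtain L where L: "L-lipschitz_on (cball 0 \<bar>R\<bar>) g" using assms bounded_cball by metis
  have "norm (g z) \<le> norm (g 0) + L * \<bar>R\<bar>" if "norm z \<le> R" for z
  proof -
    have "norm (g z - g 0) \<le> L * norm z"
      using lipschitz_onD[OF L, of z 0] that by (simp add: dist_norm)
    also have "\<dots> \<le> L * \<bar>R\<bar>"
      using that lipschitz_on_nonneg[OF L] by (intro mult_left_mono) auto
    finally show ?thesis using norm_triangle_ineq2[of "g z" "g 0"] by linarith
  qed
  then show ?thesis by blast
qed

text \<open>Integer horizons suffice, and countably many null sets have a null union. Each horizon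
  has its own \<open>\<xi>\<close>; solving the equation for it gives an expression common to all of
  them.\<close>

lemma global_strong_solution_AE:
  assumes sol: "global_strong_solution \<gamma> \<beta> \<phi> g x0 v0 x v"
  obtains N where "negligible N"
    "\<And>t. 0 < t \<Longrightarrow> t \<notin> N \<Longrightarrow> (x has_vector_derivative v t) (at t) \<and>
       (v has_vector_derivative vector_derivative v (at t)) (at t) \<and>
       - (vector_derivative v (at t) + \<gamma> *\<^sub>R v t + g (x t + \<beta> *\<^sub>R v t)) \<in> subdifferential \<phi> (v t)"
proof -
  define Q where "Q t \<longleftrightarrow> (x has_vector_derivative v t) (at t) \<and>
       (v has_vector_derivative vector_derivative v (at t)) (at t) \<and>
       - (vector_derivative v (at t) + \<gamma> *\<^sub>R v t + g (x t + \<beta> *\<^sub>R v t)) \<in> subdifferential \<phi> (v t)" for t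
  have "AE t in lebesgue. t \<in> {0<..<real (Suc n)} \<longrightarrow> Q t" for n
  proof -
    define T where "T = real (Suc n)"
    have S: "strong_solution \<gamma> \<beta> \<phi> g x0 v0 T x v"
      using sol unfolding global_strong_solution_def T_def by simp
    from S have 1: "AE t in lebesgue_on {0<..<T}. x differentiable (at t)"
      and 2: "AE t in lebesgue_on {0<..<T}. v differentiable (at t)"
      and 3: "AE t in lebesgue_on {0<..<T}. v t = vector_derivative x (at t)"
      unfolding strong_solution_def W12_def by auto
    from S obtain \<xi> where 4: "AE t in lebesgue_on {0<..<T}. \<xi> t \<in> subdifferential \<phi> (v t) \<and>
        vector_derivative v (at t) + \<gamma> *\<^sub>R v t + \<xi> t + g (x t + \<beta> *\<^sub>R v t) = 0"
      unfolding strong_solution_def by blast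
    from 1 2 3 4 have "AE t in lebesgue_on {0<..<T}. Q t"
    proof eventually_elim
      case (elim t)
      then have "\<xi> t + (vector_derivative v (at t) + \<gamma> *\<^sub>R v t + g (x t + \<beta> *\<^sub>R v t)) = 0"
        by (simp only: add_ac)
      then have "\<xi> t = - (vector_derivative v (at t) + \<gamma> *\<^sub>R v t + g (x t + \<beta> *\<^sub>R v t))"
        by (simp only: eq_neg_iff_add_eq_0)
      with elim show ?case by (simp add: Q_def vector_derivative_works)
    qed
    then show ?thesis
      unfolding T_def by (subst (asm) AE_restrict_space_iff) auto
  qed
  then have "AE t in lebesgue. \<forall>n. t \<in> {0<..<real (Suc n)} \<longrightarrow> Q t"
    unfolding AE_all_countable by blast
  then obtain N where N: "negligible N" "{t. \<not> (\<forall>n. t \<in> {0<..<real (Suc n)} \<longrightarrow> Q t)} \<subseteq> N"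
    unfolding eventually_ae_filter_negligible by blast
  have "Q t" if t: "0 < t" "t \<notin> N" for t
  proof -
    obtain k where "t \<le> real k" using real_arch_simple by blast
    then have "t \<in> {0<..<real (Suc k)}" using t by simp
    with N(2) t(2) show ?thesis by blast
  qed
  with N(1) show thesis using that unfolding Q_def by blast
qed

theorem theorem2p9:
  fixes f :: "'a::{real_inner, complete_space} \<Rightarrow> real"
    and gradf :: "'a \<Rightarrow> 'a"
    and \<phi> :: "'a \<Rightarrow> ereal"
    and \<gamma> \<beta> r :: real
    and x0 v0 :: 'a
    and x v y :: "real \<Rightarrow> 'a"
  assumes "\<gamma> > 0" and "\<beta> \<ge> 0"
    and "\<And>z. GDERIV f z :> gradf z"
    and "continuous_on UNIV gradf"
    and "\<And>B. bounded B \<Longrightarrow> \<exists>L. L-lipschitz_on B gradf"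
    and "bdd_below (range f)"
    and "proper_fun \<phi>" and "lower_semicont \<phi>" and "convex_fun \<phi>"
    and "\<phi> 0 = 0" and "\<And>z. 0 \<le> \<phi> z"
    and "r > 0" and "cball 0 r \<subseteq> subdifferential \<phi> 0"
    and "v0 \<in> dom_subdifferential \<phi>"
    and "global_strong_solution \<gamma> \<beta> \<phi> gradf x0 v0 x v"
    and "\<And>t. y t = x t + \<beta> *\<^sub>R v t"
  shows "set_integrable lborel {0..} (\<lambda>t. norm (v t)) \<and>
    (\<exists>xinf. (x \<longlongrightarrow> xinf) at_top \<and> (v \<longlongrightarrow> 0) at_top \<and> (y \<longlongrightarrow> xinf) at_top \<and>
       - gradf xinf \<in> subdifferential \<phi> 0 \<and>
       (\<forall>t\<ge>0. norm (x t - xinf) \<le> (LBINT s:{t..}. norm (v s))))"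
proof -
  obtain N where N: "negligible N"
    "\<And>t. 0 < t \<Longrightarrow> t \<notin> N \<Longrightarrow> (x has_vector_derivative v t) (at t) \<and>
       (v has_vector_derivative vector_derivative v (at t)) (at t) \<and>
       - (vector_derivative v (at t) + \<gamma> *\<^sub>R v t + gradf (x t + \<beta> *\<^sub>R v t)) \<in> subdifferential \<phi> (v t)"
    using global_strong_solution_AE[OF assms(15)] by blast
  have x_deriv: "\<And>t. 0 < t \<Longrightarrow> t \<notin> N \<Longrightarrow> (x has_vector_derivative v t) (at t)"
    and v_deriv: "\<And>t. 0 < t \<Longrightarrow> t \<notin> N \<Longrightarrow> (v has_vector_derivative vector_derivative v (at t)) (at t)"
    and inclusion: "\<And>t. 0 < t \<Longrightarrow> t \<notin> N \<Longrightarrow>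
      - (vector_derivative v (at t) + \<gamma> *\<^sub>R v t + gradf (x t + \<beta> *\<^sub>R v t)) \<in> subdifferential \<phi> (v t)"
    using N(2) by simp_all
  obtain m where m: "\<And>z. m \<le> f z"
    using assms(6) unfolding bdd_below_def by blast
  have sol: "strong_solution \<gamma> \<beta> \<phi> gradf x0 v0 T x v" if "0 < T" for T
    using assms(15) that unfolding global_strong_solution_def by simp
  interpret tr: dissipative_trajectory f gradf \<phi> \<gamma> \<beta> r m x v "\<lambda>t. vector_derivative v (at t)" N
  proof (unfold_locales)
    show "\<exists>K. \<forall>z. norm z \<le> R \<longrightarrow> norm (gradf z) \<le> K" for R
      by (rule lipschitz_on_bounded_imp_bounded[OF assms(5)])
    \<comment> \<open>The subdifferential is empty wherever \<open>\<phi>\<close> is infinite, so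
      \<open>v0\<close> lies in the effective domain.\<close>
    show "\<phi> (v 0) \<noteq> \<infinity>"
      using sol[of 1] assms(14)
      by (auto simp: strong_solution_def dom_subdifferential_def subdifferential_def)
    fix T :: real assume T: "0 < T"
    show "abs_cont_on {0..T} x" "abs_cont_on {0..T} v"
      using sol[OF T] by (simp_all add: strong_solution_def W12_def)
    have "integrable (lebesgue_on {0<..<T}) (\<lambda>t. (norm (vector_derivative v (at t)))\<^sup>2)"
      using sol[OF T] by (simp add: strong_solution_def W12_def L2_def)
    then have "(\<lambda>t. (norm (vector_derivative v (at t)))\<^sup>2) integrable_on {0<..<T}"
      by (rule integrable_on_lebesgue_on) simp
    then show "(\<lambda>t. (norm (vector_derivative v (at t)))\<^sup>2) integrable_on {0..T}"
      using integrable_on_open_interval[of "\<lambda>t. (norm (vector_derivative v (at t)))\<^sup>2" 0 T] by simp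
  qed (fact assms m N(1) x_deriv v_deriv inclusion)+
  obtain xinf where xinf: "(x \<longlongrightarrow> xinf) at_top"
    "\<And>t. 0 \<le> t \<Longrightarrow> norm (x t - xinf) \<le> (LBINT s:{t..}. norm (v s))"
    using tr.trajectory_converges by blast
  have "y = tr.y" using assms(16) by (simp add: tr.y_def fun_eq_iff)
  then show ?thesis
    using tr.set_integrable_norm_v xinf tr.velocity_vanishes tr.y_converges[OF xinf(1)]
      tr.limit_stationary[OF xinf(1)] by blast
qed

end
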